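(* Any solvable symplectic Lie algebra possessing a nonzero isotropic ideal can be obtained through a finite sequence of symplectic double extensions by a line or a plane, starting from a solvable symplectic Lie algebra without any nonzero isotropic ideal.
   Context: All Lie algebras are real and finite-dimensional. A symplectic Lie algebra $(\mathfrak g,[\cdot,\cdot],\omega)$ is a Lie algebra with a nondegenerate skew-symmetric bilinear form $\omega$ satisfying $\omega([x,y],z)+\omega([y,z],x)+\omega([z,x],y)=0$ for all $x,y,z$. For a subspace $\mathfrak m$, $\mathfrak m^\perp=\{x:\omega(x,y)=0\ \forall y\in\mathfrak m\}$; $\mathfrak m$ is isotropic if $\mathfrak m\subset\mathfrak m^\perp$. The zero Lie algebra is allowed as a (solvable) symplectic Lie algebra (it has no nonzero isotropic ideal). Isomorphisms of symplectic Lie algebras are Lie algebra isomorphisms preserving the symplectic forms. Below, brackets that are not listed are zero or given by skew-symmetry, and $x,y$ range over $\mathfrak a$. Double extension by a line. Let $(\mathfrak a,[\cdot,\cdot]_{\mathfrak a},\omega_{\mathfrak a})$ be a symplectic Lie algebra, $p,q\in\mathfrak a$, $D\in\mathfrak{gl}(\mathfrak a)$, $\varepsilon\in\mathbb R$. On $\mathfrak g=\mathbb R d_0\oplus\mathfrak a\oplus\mathbb R e_0$ put $[e_0,d_0]=\varepsilon e_0$, $[d_0,x]=\omega_{\mathfrak a}(p,x)d_0+D(x)+\omega_{\mathfrak a}(q,x)e_0$, $[x,e_0]=\omega_{\mathfrak a}(p,x)e_0$, $[x,y]=[x,y]_{\mathfrak a}+\big(\omega_{\mathfrak a}(D(x),y)+\omega_{\mathfrak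 a}(x,D(y))\big)e_0$, and let $\omega$ extend $\omega_{\mathfrak a}$ with $\omega(d_0,e_0)=1$ and $\mathfrak a\perp\mathrm{span}\{d_0,e_0\}$. When $(p,q,D,\varepsilon)$ is such that $(\mathfrak g,[\cdot,\cdot],\omega)$ is a symplectic Lie algebra, it is called a symplectic double extension of $(\mathfrak a,[\cdot,\cdot]_{\mathfrak a},\omega_{\mathfrak a})$ by a line. Double extension by a plane. Let $a_0,a_1,b_0,b_1,b_2,z\in\mathfrak a$, $D_0,D_1\in\mathfrak{gl}(\mathfrak a)$, $\varepsilon_0,\dots,\varepsilon_5\in\mathbb R$. On $\mathfrak g=\mathbb R d_0\oplus\mathbb R d_1\oplus\mathfrak a\oplus\mathbb R e_0\oplus\mathbb R e_1$ put $[d_0,e_0]=\varepsilon_0e_0+\varepsilon_1e_1$, $[d_0,e_1]=-\varepsilon_1e_0+\varepsilon_0e_1$, $[d_1,e_0]=\varepsilon_2e_0+\varepsilon_3e_1$, $[d_1,e_1]=-\varepsilon_3e_0+\varepsilon_2e_1$, $[d_0,d_1]=(\varepsilon_2-\varepsilon_1)d_0-(\varepsilon_0+\varepsilon_3)d_1+z+\varepsilon_4e_0+\varepsilon_5e_1$, $[d_0,x]=\omega_{\mathfrak a}(a_0,x)d_0+\omega_{\mathfrak a}(a_1,x)d_1+D_0(x)+\omega_{\mathfrak a}(b_0,x)e_0+\omega_{\mathfrak a}(b_1,x)e_1$, $[d_1,x]=-\omega_{\mathfrak a}(a_1,x)d_0+\omega_{\mathfrak a}(a_0,x)d_1+D_1(x)+\omega_{\mathfrak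 a}(b_1+z,x)e_0+\omega_{\mathfrak a}(b_2,x)e_1$, $[e_0,x]=-\omega_{\mathfrak a}(a_0,x)e_0+\omega_{\mathfrak a}(a_1,x)e_1$, $[e_1,x]=-\omega_{\mathfrak a}(a_1,x)e_0-\omega_{\mathfrak a}(a_0,x)e_1$, $[x,y]=[x,y]_{\mathfrak a}+\sum_{k=0}^1\big(\omega_{\mathfrak a}(D_k(x),y)+\omega_{\mathfrak a}(x,D_k(y))\big)e_k$, and $\omega=\omega_{\mathfrak a}+d_0^*\wedge e_0^*+d_1^*\wedge e_1^*$. When the data are such that $(\mathfrak g,[\cdot,\cdot],\omega)$ is a symplectic Lie algebra, it is called a symplectic double extension of $(\mathfrak a,[\cdot,\cdot]_{\mathfrak a},\omega_{\mathfrak a})$ by a plane. "Obtained through a finite sequence of double extensions starting from $\mathfrak a_0$" means: there are symplectic Lie algebras $\mathfrak a_0,\mathfrak a_1,\dots,\mathfrak a_n$ with $\mathfrak a_n$ isomorphic to the given one and each $\mathfrak a_{i+1}$ isomorphic to a symplectic double extension of $\mathfrak a_i$ by a line or a plane. *)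

theory Defs
  imports "HOL-Analysis.Analysis"
begin

text \<open>
  A (candidate) symplectic Lie algebra lives on a linear subspace of an ambient real vector
  space. Bracket and form are total functions, but only their values on the subspace matter.
\<close>

record 'a symp_lie =
  sl_space :: "'a set"
  sl_bracket :: "'a \<Rightarrow> 'a \<Rightarrow> 'a"
  sl_form :: "'a \<Rightarrow> 'a \<Rightarrow> real"

definition linear_map_on ::
  "'a::real_vector set \<Rightarrow> 'b::real_vector set \<Rightarrow> ('a \<Rightarrow> 'b) \<Rightarrow> bool" where
  "linear_map_on V W f \<longleftrightarrow>
     (\<forall>x\<in>V. f x \<in> W) \<and>
     (\<forall>x\<in>V. \<forall>y\<in>V. f (x + y) = f x + f y) \<and>
     (\<forall>c. \<forall>x\<in>V. f (c *\<^sub>R x) = c *\<^sub>R f x)"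

definition bilinear_map_on ::
  "'a::real_vector set \<Rightarrow> 'b::real_vector set \<Rightarrow> ('a \<Rightarrow> 'a \<Rightarrow> 'b) \<Rightarrow> bool" where
  "bilinear_map_on V W b \<longleftrightarrow>
     (\<forall>x\<in>V. linear_map_on V W (\<lambda>y. b x y)) \<and> (\<forall>y\<in>V. linear_map_on V W (\<lambda>x. b x y))"

definition lie_algebra_on :: "'a::real_vector set \<Rightarrow> ('a \<Rightarrow> 'a \<Rightarrow> 'a) \<Rightarrow> bool" where
  "lie_algebra_on V b \<longleftrightarrow>
     subspace V \<and> (\<exists>B. finite B \<and> span B = V) \<and>
     bilinear_map_on V V b \<and>
     (\<forall>x\<in>V. b x x = 0) \<and>
     (\<forall>x\<in>V. \<forall>y\<in>V. \<forall>z\<in>V. b x (b y z) + b y (b z x) + b z (b x y) = 0)"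

definition symplectic_lie_algebra :: "'a::real_vector symp_lie \<Rightarrow> bool" where
  "symplectic_lie_algebra \<gg> \<longleftrightarrow>
     (let V = sl_space \<gg>; b = sl_bracket \<gg>; \<omega> = sl_form \<gg> in
        lie_algebra_on V b \<and>
        bilinear_map_on V UNIV \<omega> \<and>
        (\<forall>x\<in>V. \<forall>y\<in>V. \<omega> x y = - \<omega> y x) \<and>
        (\<forall>x\<in>V. (\<forall>y\<in>V. \<omega> x y = 0) \<longrightarrow> x = 0) \<and>
        (\<forall>x\<in>V. \<forall>y\<in>V. \<forall>z\<in>V. \<omega> (b x y) z + \<omega> (b y z) x + \<omega> (b z x) y = 0))"

fun lie_derived_series :: "'a::real_vector symp_lie \<Rightarrow> nat \<Rightarrow> 'a set" where
  "lie_derived_series \<gg> 0 = sl_space \<gg>"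
| "lie_derived_series \<gg> (Suc k) =
     span {sl_bracket \<gg> x y | x y.
             x \<in> lie_derived_series \<gg> k \<and> y \<in> lie_derived_series \<gg> k}"

definition lie_solvable :: "'a::real_vector symp_lie \<Rightarrow> bool" where
  "lie_solvable \<gg> \<longleftrightarrow> (\<exists>k. lie_derived_series \<gg> k = {0})"

definition lie_ideal :: "'a::real_vector symp_lie \<Rightarrow> 'a set \<Rightarrow> bool" where
  "lie_ideal \<gg> I \<longleftrightarrow>
     subspace I \<and> I \<subseteq> sl_space \<gg> \<and> (\<forall>x\<in>sl_space \<gg>. \<forall>y\<in>I. sl_bracket \<gg> x y \<in> I)"

definition symp_perp :: "'a::real_vector symp_lie \<Rightarrow> 'a set \<Rightarrow> 'a set" where
  "symp_perp \<gg> M = {x \<in> sl_space \<gg>. \<forall>y\<in>M. sl_form \<gg> x y = 0}"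

definition symp_isotropic :: "'a::real_vector symp_lie \<Rightarrow> 'a set \<Rightarrow> bool" where
  "symp_isotropic \<gg> M \<longleftrightarrow> M \<subseteq> symp_perp \<gg> M"

definition symp_lie_isomorphic ::
  "'a::real_vector symp_lie \<Rightarrow> 'b::real_vector symp_lie \<Rightarrow> bool" where
  "symp_lie_isomorphic \<gg> \<hh> \<longleftrightarrow>
     (\<exists>f. linear_map_on (sl_space \<gg>) (sl_space \<hh>) f \<and>
          bij_betw f (sl_space \<gg>) (sl_space \<hh>) \<and>
          (\<forall>x\<in>sl_space \<gg>. \<forall>y\<in>sl_space \<gg>.
             f (sl_bracket \<gg> x y) = sl_bracket \<hh> (f x) (f y) \<and>
             sl_form \<hh> (f x) (f y) = sl_form \<gg> x y))"


subsection \<open>Double extension by a line\<close>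

text \<open>
  The triple \<open>(s, x, t)\<close> stands for \<open>s d0 + x + t e0\<close>, and the bracket is the closed form of the
  bilinear alternating extension of the relations between \<open>d0\<close>, \<open>e0\<close> and elements of \<open>\<aa>\<close>. These
  relations are stated in \<open>line_extension_relations\<close> below.
\<close>

definition line_extension ::
  "'a::real_vector symp_lie \<Rightarrow> 'a \<Rightarrow> 'a \<Rightarrow> ('a \<Rightarrow> 'a) \<Rightarrow> real \<Rightarrow>
     (real \<times> 'a \<times> real) symp_lie" where
  "line_extension \<aa> p q D \<epsilon> =
     (let \<omega> = sl_form \<aa> in
      \<lparr> sl_space = UNIV \<times> sl_space \<aa> \<times> UNIV,
        sl_bracket = (\<lambda>(s, x, t) (s', x', t').
          (s * \<omega> p x' - s' * \<omega> p x,
           s *\<^sub>R D x' - s' *\<^sub>R D x + sl_bracket \<aa> x x',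
           \<epsilon> * (t * s' - s * t') + (s * \<omega> q x' - s' * \<omega> q x)
             + (t' * \<omega> p x - t * \<omega> p x') + (\<omega> (D x) x' + \<omega> x (D x')))),
        sl_form = (\<lambda>(s, x, t) (s', x', t'). \<omega> x x' + (s * t' - t * s')) \<rparr>)"

definition is_line_double_extension ::
  "'a::real_vector symp_lie \<Rightarrow> (real \<times> 'a \<times> real) symp_lie \<Rightarrow> bool" where
  "is_line_double_extension \<aa> \<gg> \<longleftrightarrow>
     symplectic_lie_algebra \<aa> \<and> symplectic_lie_algebra \<gg> \<and>
     (\<exists>p\<in>sl_space \<aa>. \<exists>q\<in>sl_space \<aa>. \<exists>D \<epsilon>.
        linear_map_on (sl_space \<aa>) (sl_space \<aa>) D \<and> \<gg> = line_extension \<aa> p q D \<epsilon>)"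


subsection \<open>Double extension by a plane\<close>

text \<open>
  The tuple \<open>(s0, s1, x, t0, t1)\<close> stands for \<open>s0 d0 + s1 d1 + x + t0 e0 + t1 e1\<close>. The relations
  from which the closed form of the bracket arises are stated in \<open>plane_extension_relations\<close>
  below.
\<close>

definition plane_extension ::
  "'a::real_vector symp_lie \<Rightarrow> 'a \<Rightarrow> 'a \<Rightarrow> 'a \<Rightarrow> 'a \<Rightarrow> 'a \<Rightarrow> 'a \<Rightarrow> ('a \<Rightarrow> 'a) \<Rightarrow> ('a \<Rightarrow> 'a) \<Rightarrow>
     real \<Rightarrow> real \<Rightarrow> real \<Rightarrow> real \<Rightarrow> real \<Rightarrow> real \<Rightarrow>
     (real \<times> real \<times> 'a \<times> real \<times> real) symp_lie" where
  "plane_extension \<aa> a0 a1 b0 b1 b2 z D0 D1 \<epsilon>0 \<epsilon>1 \<epsilon>2 \<epsilon>3 \<epsilon>4 \<epsilon>5 =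
     (let \<omega> = sl_form \<aa> in
      \<lparr> sl_space = UNIV \<times> UNIV \<times> sl_space \<aa> \<times> UNIV \<times> UNIV,
        sl_bracket = (\<lambda>(s0, s1, x, t0, t1) (s0', s1', x', t0', t1').
          ((\<epsilon>2 - \<epsilon>1) * (s0 * s1' - s1 * s0')
             + (s0 * \<omega> a0 x' - s0' * \<omega> a0 x) - (s1 * \<omega> a1 x' - s1' * \<omega> a1 x),
           - (\<epsilon>0 + \<epsilon>3) * (s0 * s1' - s1 * s0')
             + (s0 * \<omega> a1 x' - s0' * \<omega> a1 x) + (s1 * \<omega> a0 x' - s1' * \<omega> a0 x),
           (s0 * s1' - s1 * s0') *\<^sub>R z
             + (s0 *\<^sub>R D0 x' - s0' *\<^sub>R D0 x) + (s1 *\<^sub>R D1 x' - s1' *\<^sub>R D1 x)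
             + sl_bracket \<aa> x x',
           \<epsilon>4 * (s0 * s1' - s1 * s0')
             + \<epsilon>0 * (s0 * t0' - t0 * s0') - \<epsilon>1 * (s0 * t1' - t1 * s0')
             + \<epsilon>2 * (s1 * t0' - t0 * s1') - \<epsilon>3 * (s1 * t1' - t1 * s1')
             + (s0 * \<omega> b0 x' - s0' * \<omega> b0 x) + (s1 * \<omega> (b1 + z) x' - s1' * \<omega> (b1 + z) x)
             - (t0 * \<omega> a0 x' - t0' * \<omega> a0 x) - (t1 * \<omega> a1 x' - t1' * \<omega> a1 x)
             + (\<omega> (D0 x) x' + \<omega> x (D0 x')),
           \<epsilon>5 * (s0 * s1' - s1 * s0')
             + \<epsilon>1 * (s0 * t0' - t0 * s0') + \<epsilon>0 * (s0 * t1' - t1 * s0')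
             + \<epsilon>3 * (s1 * t0' - t0 * s1') + \<epsilon>2 * (s1 * t1' - t1 * s1')
             + (s0 * \<omega> b1 x' - s0' * \<omega> b1 x) + (s1 * \<omega> b2 x' - s1' * \<omega> b2 x)
             + (t0 * \<omega> a1 x' - t0' * \<omega> a1 x) - (t1 * \<omega> a0 x' - t1' * \<omega> a0 x)
             + (\<omega> (D1 x) x' + \<omega> x (D1 x')))),
        sl_form = (\<lambda>(s0, s1, x, t0, t1) (s0', s1', x', t0', t1').
          \<omega> x x' + (s0 * t0' - t0 * s0') + (s1 * t1' - t1 * s1')) \<rparr>)"

definition is_plane_double_extension ::
  "'a::real_vector symp_lie \<Rightarrow> (real \<times> real \<times> 'a \<times> real \<times> real) symp_lie \<Rightarrow> bool" where
  "is_plane_double_extension \<aa> \<gg> \<longleftrightarrow>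
     symplectic_lie_algebra \<aa> \<and> symplectic_lie_algebra \<gg> \<and>
     (\<exists>a0\<in>sl_space \<aa>. \<exists>a1\<in>sl_space \<aa>. \<exists>b0\<in>sl_space \<aa>. \<exists>b1\<in>sl_space \<aa>. \<exists>b2\<in>sl_space \<aa>.
      \<exists>z\<in>sl_space \<aa>. \<exists>D0 D1 \<epsilon>0 \<epsilon>1 \<epsilon>2 \<epsilon>3 \<epsilon>4 \<epsilon>5.
        linear_map_on (sl_space \<aa>) (sl_space \<aa>) D0 \<and>
        linear_map_on (sl_space \<aa>) (sl_space \<aa>) D1 \<and>
        \<gg> = plane_extension \<aa> a0 a1 b0 b1 b2 z D0 D1 \<epsilon>0 \<epsilon>1 \<epsilon>2 \<epsilon>3 \<epsilon>4 \<epsilon>5)"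


subsection \<open>Sequences of double extensions\<close>

text \<open>
  All members of the sequence live on subspaces of the ambient space of the final algebra.
  This is no restriction: dimensions increase along the sequence, so every member can be
  transported, up to isomorphism, to a subspace of the space of the last one.
\<close>

definition obtained_by_double_extensions ::
  "'a::real_vector symp_lie \<Rightarrow> 'a symp_lie \<Rightarrow> bool" where
  "obtained_by_double_extensions \<aa>\<^sub>0 \<gg> \<longleftrightarrow>
     (\<exists>(n::nat) (\<aa> :: nat \<Rightarrow> 'a symp_lie).
        \<aa> 0 = \<aa>\<^sub>0 \<and>
        (\<forall>i\<le>n. symplectic_lie_algebra (\<aa> i)) \<and>
        (\<forall>i<n. (\<exists>\<hh>. is_line_double_extension (\<aa> i) \<hh> \<and> symp_lie_isomorphic (\<aa> (Suc i)) \<hh>) \<or>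
               (\<exists>\<hh>. is_plane_double_extension (\<aa> i) \<hh> \<and> symp_lie_isomorphic (\<aa> (Suc i)) \<hh>)) \<and>
        symp_lie_isomorphic (\<aa> n) \<gg>)"


subsection \<open>Defining relations of the double extensions\<close>

lemma symplectic_lie_algebraD:
  assumes "symplectic_lie_algebra \<aa>"
  shows "subspace (sl_space \<aa>)"
    and "bilinear_map_on (sl_space \<aa>) (sl_space \<aa>) (sl_bracket \<aa>)"
    and "bilinear_map_on (sl_space \<aa>) UNIV (sl_form \<aa>)"
  using assms unfolding symplectic_lie_algebra_def lie_algebra_on_def Let_def
  by - (elim conjE, assumption)+

lemma linear_map_on_zero:
  assumes "linear_map_on V W f" "subspace V"
  shows "f 0 = 0"
proof -
  have "\<forall>c. \<forall>x\<in>V. f (c *\<^sub>R x) = c *\<^sub>R f x"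
    using assms(1) unfolding linear_map_on_def by (elim conjE)
  from this[rule_format, of 0 0] show ?thesis
    using subspace_0[OF assms(2)] by simp
qed

lemma bilinear_map_on_zero:
  assumes "bilinear_map_on V W b" "subspace V" "x \<in> V"
  shows "b x 0 = 0" "b 0 x = 0"
proof -
  have 1: "\<forall>x\<in>V. linear_map_on V W (\<lambda>y. b x y)" and 2: "\<forall>y\<in>V. linear_map_on V W (\<lambda>x. b x y)"
    using assms(1) unfolding bilinear_map_on_def by - (elim conjE, assumption)+
  show "b x 0 = 0"
    by (rule linear_map_on_zero[OF bspec[OF 1 assms(3)] assms(2)])
  show "b 0 x = 0"
    by (rule linear_map_on_zero[OF bspec[OF 2 assms(3)] assms(2)])
qed

lemma symplectic_lie_algebra_zero:
  assumes "symplectic_lie_algebra \<aa>" "x \<in> sl_space \<aa>"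
  shows "sl_bracket \<aa> x 0 = 0" "sl_bracket \<aa> 0 x = 0"
    "sl_form \<aa> x 0 = 0" "sl_form \<aa> 0 x = 0"
  by (rule bilinear_map_on_zero[OF symplectic_lie_algebraD(2)[OF assms(1)]
        symplectic_lie_algebraD(1)[OF assms(1)] assms(2)]
      bilinear_map_on_zero[OF symplectic_lie_algebraD(3)[OF assms(1)]
        symplectic_lie_algebraD(1)[OF assms(1)] assms(2)])+

lemma line_extension_relations:
  fixes \<aa> :: "'a::real_vector symp_lie" and p q :: 'a and D :: "'a \<Rightarrow> 'a" and \<epsilon> :: real
  defines "\<gg> \<equiv> line_extension \<aa> p q D \<epsilon>"
  defines "d0 \<equiv> (1, 0, 0)" and "e0 \<equiv> (0, 0, 1)" and "\<iota> \<equiv> \<lambda>x. (0, x, 0)"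
  assumes \<aa>: "symplectic_lie_algebra \<aa>" and D: "linear_map_on (sl_space \<aa>) (sl_space \<aa>) D"
    and V: "p \<in> sl_space \<aa>" "q \<in> sl_space \<aa>" "x \<in> sl_space \<aa>" "y \<in> sl_space \<aa>"
  shows "sl_bracket \<gg> e0 d0 = \<epsilon> *\<^sub>R e0"
    "sl_bracket \<gg> d0 (\<iota> x) = sl_form \<aa> p x *\<^sub>R d0 + \<iota> (D x) + sl_form \<aa> q x *\<^sub>R e0"
    "sl_bracket \<gg> (\<iota> x) e0 = sl_form \<aa> p x *\<^sub>R e0"
    "sl_bracket \<gg> (\<iota> x) (\<iota> y) =
       \<iota> (sl_bracket \<aa> x y) + (sl_form \<aa> (D x) y + sl_form \<aa> x (D y)) *\<^sub>R e0"
    "sl_form \<gg> d0 e0 = 1" "sl_form \<gg> (\<iota> x) (\<iota> y) = sl_form \<aa> x y"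
    "sl_form \<gg> (\<iota> x) d0 = 0" "sl_form \<gg> (\<iota> x) e0 = 0"
proof -
  have 0: "0 \<in> sl_space \<aa>"
    by (rule subspace_0[OF symplectic_lie_algebraD(1)[OF \<aa>]])
  note [simp] = symplectic_lie_algebra_zero[OF \<aa> 0]
    symplectic_lie_algebra_zero[OF \<aa> V(1)] symplectic_lie_algebra_zero[OF \<aa> V(2)]
    symplectic_lie_algebra_zero[OF \<aa> V(3)]
    linear_map_on_zero[OF D symplectic_lie_algebraD(1)[OF \<aa>]]
  have [simp]: "sl_form \<aa> (D x) 0 = 0" "sl_form \<aa> 0 (D x) = 0"
    using D V(3) unfolding linear_map_on_def
    by (auto intro: symplectic_lie_algebra_zero[OF \<aa>])
  show "sl_bracket \<gg> e0 d0 = \<epsilon> *\<^sub>R e0"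
    "sl_bracket \<gg> d0 (\<iota> x) = sl_form \<aa> p x *\<^sub>R d0 + \<iota> (D x) + sl_form \<aa> q x *\<^sub>R e0"
    "sl_bracket \<gg> (\<iota> x) e0 = sl_form \<aa> p x *\<^sub>R e0"
    "sl_bracket \<gg> (\<iota> x) (\<iota> y) =
       \<iota> (sl_bracket \<aa> x y) + (sl_form \<aa> (D x) y + sl_form \<aa> x (D y)) *\<^sub>R e0"
    "sl_form \<gg> d0 e0 = 1" "sl_form \<gg> (\<iota> x) (\<iota> y) = sl_form \<aa> x y"
    "sl_form \<gg> (\<iota> x) d0 = 0" "sl_form \<gg> (\<iota> x) e0 = 0"
    by (simp_all add: assms(1-4) line_extension_def Let_def)
qed

lemma plane_extension_relations:
  fixes \<aa> :: "'a::real_vector symp_lie" and a0 a1 b0 b1 b2 z :: 'a and D0 D1 :: "'a \<Rightarrow> 'a"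
    and \<epsilon>0 \<epsilon>1 \<epsilon>2 \<epsilon>3 \<epsilon>4 \<epsilon>5 :: real
  defines "\<gg> \<equiv> plane_extension \<aa> a0 a1 b0 b1 b2 z D0 D1 \<epsilon>0 \<epsilon>1 \<epsilon>2 \<epsilon>3 \<epsilon>4 \<epsilon>5"
  defines "d0 \<equiv> (1, 0, 0, 0, 0)" and "d1 \<equiv> (0, 1, 0, 0, 0)"
    and "e0 \<equiv> (0, 0, 0, 1, 0)" and "e1 \<equiv> (0, 0, 0, 0, 1)" and "\<iota> \<equiv> \<lambda>x. (0, 0, x, 0, 0)"
  assumes \<aa>: "symplectic_lie_algebra \<aa>"
    and D: "linear_map_on (sl_space \<aa>) (sl_space \<aa>) D0"
      "linear_map_on (sl_space \<aa>) (sl_space \<aa>) D1"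
    and V: "a0 \<in> sl_space \<aa>" "a1 \<in> sl_space \<aa>" "b0 \<in> sl_space \<aa>" "b1 \<in> sl_space \<aa>" "b2 \<in> sl_space \<aa>"
    "z \<in> sl_space \<aa>" "x \<in> sl_space \<aa>" "y \<in> sl_space \<aa>"
  shows
    "sl_bracket \<gg> d0 e0 = \<epsilon>0 *\<^sub>R e0 + \<epsilon>1 *\<^sub>R e1"
    "sl_bracket \<gg> d0 e1 = - \<epsilon>1 *\<^sub>R e0 + \<epsilon>0 *\<^sub>R e1"
    "sl_bracket \<gg> d1 e0 = \<epsilon>2 *\<^sub>R e0 + \<epsilon>3 *\<^sub>R e1"
    "sl_bracket \<gg> d1 e1 = - \<epsilon>3 *\<^sub>R e0 + \<epsilon>2 *\<^sub>R e1"
    "sl_bracket \<gg> e0 e1 = 0"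
    "sl_bracket \<gg> d0 d1 =
       (\<epsilon>2 - \<epsilon>1) *\<^sub>R d0 - (\<epsilon>0 + \<epsilon>3) *\<^sub>R d1 + \<iota> z + \<epsilon>4 *\<^sub>R e0 + \<epsilon>5 *\<^sub>R e1"
    "sl_bracket \<gg> d0 (\<iota> x) =
       sl_form \<aa> a0 x *\<^sub>R d0 + sl_form \<aa> a1 x *\<^sub>R d1 + \<iota> (D0 x)
         + sl_form \<aa> b0 x *\<^sub>R e0 + sl_form \<aa> b1 x *\<^sub>R e1"
    "sl_bracket \<gg> d1 (\<iota> x) =
       - sl_form \<aa> a1 x *\<^sub>R d0 + sl_form \<aa> a0 x *\<^sub>R d1 + \<iota> (D1 x)
         + sl_form \<aa> (b1 + z) x *\<^sub>R e0 + sl_form \<aa> b2 x *\<^sub>R e1"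
    "sl_bracket \<gg> e0 (\<iota> x) = - sl_form \<aa> a0 x *\<^sub>R e0 + sl_form \<aa> a1 x *\<^sub>R e1"
    "sl_bracket \<gg> e1 (\<iota> x) = - sl_form \<aa> a1 x *\<^sub>R e0 - sl_form \<aa> a0 x *\<^sub>R e1"
    "sl_bracket \<gg> (\<iota> x) (\<iota> y) =
       \<iota> (sl_bracket \<aa> x y) + (sl_form \<aa> (D0 x) y + sl_form \<aa> x (D0 y)) *\<^sub>R e0
         + (sl_form \<aa> (D1 x) y + sl_form \<aa> x (D1 y)) *\<^sub>R e1"
    "sl_form \<gg> d0 e0 = 1" "sl_form \<gg> d1 e1 = 1" "sl_form \<gg> d0 e1 = 0" "sl_form \<gg> d1 e0 = 0"
    "sl_form \<gg> d0 d1 = 0" "sl_form \<gg> e0 e1 = 0" "sl_form \<gg> (\<iota> x) (\<iota> y) = sl_form \<aa> x y"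
    "sl_form \<gg> (\<iota> x) d0 = 0" "sl_form \<gg> (\<iota> x) d1 = 0"
    "sl_form \<gg> (\<iota> x) e0 = 0" "sl_form \<gg> (\<iota> x) e1 = 0"
proof -
  have 0: "0 \<in> sl_space \<aa>"
    by (rule subspace_0[OF symplectic_lie_algebraD(1)[OF \<aa>]])
  have bz: "b1 + z \<in> sl_space \<aa>"
    by (rule subspace_add[OF symplectic_lie_algebraD(1)[OF \<aa>] V(4,6)])
  note [simp] = symplectic_lie_algebra_zero[OF \<aa> 0] symplectic_lie_algebra_zero[OF \<aa> bz]
    V[THEN symplectic_lie_algebra_zero(1)[OF \<aa>]] V[THEN symplectic_lie_algebra_zero(2)[OF \<aa>]]
    V[THEN symplectic_lie_algebra_zero(3)[OF \<aa>]] V[THEN symplectic_lie_algebra_zero(4)[OF \<aa>]]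
    D[THEN linear_map_on_zero, OF symplectic_lie_algebraD(1)[OF \<aa>]]
  have [simp]: "sl_form \<aa> (D0 x) 0 = 0" "sl_form \<aa> 0 (D0 x) = 0"
      "sl_form \<aa> (D1 x) 0 = 0" "sl_form \<aa> 0 (D1 x) = 0"
    using D V(7) unfolding linear_map_on_def
    by (auto intro: symplectic_lie_algebra_zero[OF \<aa>])
  show
    "sl_bracket \<gg> d0 e0 = \<epsilon>0 *\<^sub>R e0 + \<epsilon>1 *\<^sub>R e1"
    "sl_bracket \<gg> d0 e1 = - \<epsilon>1 *\<^sub>R e0 + \<epsilon>0 *\<^sub>R e1"
    "sl_bracket \<gg> d1 e0 = \<epsilon>2 *\<^sub>R e0 + \<epsilon>3 *\<^sub>R e1"
    "sl_bracket \<gg> d1 e1 = - \<epsilon>3 *\<^sub>R e0 + \<epsilon>2 *\<^sub>R e1"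
    "sl_bracket \<gg> e0 e1 = 0"
    "sl_bracket \<gg> d0 d1 =
       (\<epsilon>2 - \<epsilon>1) *\<^sub>R d0 - (\<epsilon>0 + \<epsilon>3) *\<^sub>R d1 + \<iota> z + \<epsilon>4 *\<^sub>R e0 + \<epsilon>5 *\<^sub>R e1"
    "sl_bracket \<gg> d0 (\<iota> x) =
       sl_form \<aa> a0 x *\<^sub>R d0 + sl_form \<aa> a1 x *\<^sub>R d1 + \<iota> (D0 x)
         + sl_form \<aa> b0 x *\<^sub>R e0 + sl_form \<aa> b1 x *\<^sub>R e1"
    "sl_bracket \<gg> d1 (\<iota> x) =
       - sl_form \<aa> a1 x *\<^sub>R d0 + sl_form \<aa> a0 x *\<^sub>R d1 + \<iota> (D1 x)
         + sl_form \<aa> (b1 + z) x *\<^sub>R e0 + sl_form \<aa> b2 x *\<^sub>R e1"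
    "sl_bracket \<gg> e0 (\<iota> x) = - sl_form \<aa> a0 x *\<^sub>R e0 + sl_form \<aa> a1 x *\<^sub>R e1"
    "sl_bracket \<gg> e1 (\<iota> x) = - sl_form \<aa> a1 x *\<^sub>R e0 - sl_form \<aa> a0 x *\<^sub>R e1"
    "sl_bracket \<gg> (\<iota> x) (\<iota> y) =
       \<iota> (sl_bracket \<aa> x y) + (sl_form \<aa> (D0 x) y + sl_form \<aa> x (D0 y)) *\<^sub>R e0
         + (sl_form \<aa> (D1 x) y + sl_form \<aa> x (D1 y)) *\<^sub>R e1"
    "sl_form \<gg> d0 e0 = 1" "sl_form \<gg> d1 e1 = 1" "sl_form \<gg> d0 e1 = 0" "sl_form \<gg> d1 e0 = 0"
    "sl_form \<gg> d0 d1 = 0" "sl_form \<gg> e0 e1 = 0" "sl_form \<gg> (\<iota> x) (\<iota> y) = sl_form \<aa> x y"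
    "sl_form \<gg> (\<iota> x) d0 = 0" "sl_form \<gg> (\<iota> x) d1 = 0"
    "sl_form \<gg> (\<iota> x) e0 = 0" "sl_form \<gg> (\<iota> x) e1 = 0"
    by (simp_all add: assms(1-6) plane_extension_def Let_def zero_prod_def)
qed

end

theory Submission
  imports Defs "HOL-Computational_Algebra.Fundamental_Theorem_Algebra"
begin

text \<open>
  The theorem follows by induction on the dimension once one step is known: a solvable symplectic
  Lie algebra \<open>\<gg>\<close> with a nonzero isotropic ideal \<open>J\<close> is isomorphic to a double extension, by a line or
  a plane, of a solvable symplectic Lie algebra \<open>\<aa>\<close> of smaller dimension (\<open>reduction_step\<close>). The
  process stops exactly when no nonzero isotropic ideal is left.

  For the step, \<open>J\<close> contains an ideal of dimension one or two by Lie's theorem: \<open>\<gg>\<close> has a common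
  eigenvector in the complexification of \<open>J\<close>, whose real and imaginary parts span a line, or a plane
  on which every element acts as multiplication by a complex number (\<open>minimal_ideal_in_ideal\<close>).
  Lie's theorem itself (\<open>lie_common_eigenvector\<close>) is proved for descending chains of sets of
  operators in which commutators pass to the next set, by working in irreducible invariant subspaces.

  Let \<open>I\<close> be this line or plane; it is isotropic because \<open>J\<close> is. The cocycle identity makes the
  orthogonal space of \<open>I\<close> a subalgebra, and its quotient by \<open>I\<close> is the symplectic Lie algebra \<open>\<aa>\<close>, realised
  on a complement \<open>A\<close> of \<open>I\<close> (locale \<open>symplectic_reduction\<close>). Adding a subspace dual to \<open>I\<close> recovers \<open>\<gg>\<close>.
  The bracket of \<open>\<gg>\<close> in these coordinates involves linear functionals on \<open>A\<close>, which are
  represented by elements of \<open>A\<close> since the form is nondegenerate, and the cocycle identity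
  expresses every remaining coordinate through the data of a double extension
  (\<open>invariant_line_reduction\<close>, \<open>invariant_plane_reduction\<close>).
\<close>

section \<open>Finitely generated vector spaces\<close>

context vector_space
begin

lemma span_subset_of_card_le:
  assumes "independent C" "C \<subseteq> span B" "finite B" "card B \<le> card C"
  shows "span B \<subseteq> span C"
proof (rule ccontr)
  assume "\<not> span B \<subseteq> span C"
  then obtain y where y: "y \<in> span B" "y \<notin> span C"
    by blast
  have C: "finite C"
    using independent_span_bound[OF assms(3,1,2)] by simp
  have "independent (insert y C)"
    using y(2) assms(1) by (rule independent_insertI)
  moreover have "insert y C \<subseteq> span B"
    using y(1) assms(2) by simp
  ultimately have "card (insert y C) \<le> card B"
    using independent_span_bound[OF assms(3)] by blast
  moreover have "y \<notin> C"
    using y(2) span_base by blast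
  ultimately show False
    using C assms(4) by simp
qed

lemma dim_psubset_finite_span:
  assumes "subspace W" "W \<subseteq> U" "W \<noteq> U" "U \<subseteq> span B" "finite B"
  shows "dim W < dim U"
proof -
  obtain C where C: "C \<subseteq> W" "independent C" "W \<subseteq> span C" "card C = dim W"
    by (rule basis_exists)
  obtain D where D: "D \<subseteq> U" "independent D" "U \<subseteq> span D" "card D = dim U"
    by (rule basis_exists)
  have fD: "finite D"
    using independent_span_bound[OF assms(5) D(2)] D(1) assms(4) by blast
  have CD: "C \<subseteq> span D"
    using C(1) assms(2) D(3) by blast
  have "\<not> card D \<le> card C"
  proof
    assume "card D \<le> card C"
    from span_subset_of_card_le[OF C(2) CD fD this] have "U \<subseteq> span C"
      using D(3) by blast
    also have "span C \<subseteq> W"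
      using C(1) assms(1) by (rule span_minimal)
    finally show False
      using assms(2,3) by blast
  qed
  then show ?thesis
    using C(4) D(4) by simp
qed

text \<open>
  The vectors \<open>v, T v, T\<^sup>2 v, \<dots>\<close> cannot all be independent, so some \<open>T\<^sup>n v\<close> depends on its
  predecessors; the least such \<open>n\<close> is positive because \<open>v \<noteq> 0\<close>, hence the form \<open>Suc m\<close>.
\<close>

lemma least_iterate_in_span:
  fixes T :: "'b \<Rightarrow> 'b"
  assumes "finite B" "\<And>k. (T ^^ k) v \<in> span B" "v \<noteq> 0"
  obtains m where "(T ^^ Suc m) v \<in> span ((\<lambda>i. (T ^^ i) v) ` {..<Suc m})"
    and "(T ^^ m) v \<notin> span ((\<lambda>i. (T ^^ i) v) ` {..<m})"
proof -
  define S where "S k = span ((\<lambda>i. (T ^^ i) v) ` {..<k})" for k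
  have ex: "\<exists>n. (T ^^ n) v \<in> S n"
  proof (rule ccontr)
    assume no: "\<nexists>n. (T ^^ n) v \<in> S n"
    have ind: "independent ((\<lambda>i. (T ^^ i) v) ` {..<n}) \<and> card ((\<lambda>i. (T ^^ i) v) ` {..<n}) = n" for n
    proof (induction n)
      case (Suc n)
      have "(T ^^ n) v \<notin> span ((\<lambda>i. (T ^^ i) v) ` {..<n})"
        using no unfolding S_def by blast
      moreover from this have "(T ^^ n) v \<notin> (\<lambda>i. (T ^^ i) v) ` {..<n}"
        by (meson span_base)
      ultimately show ?case
        using Suc by (simp add: lessThan_Suc independent_insertI)
    qed (simp add: independent_empty)
    have "card ((\<lambda>i. (T ^^ i) v) ` {..<Suc (card B)}) \<le> card B"
      using independent_span_bound[OF assms(1)] ind assms(2) by blast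
    then show False
      using ind[of "Suc (card B)"] by linarith
  qed
  define n where "n = (LEAST n. (T ^^ n) v \<in> S n)"
  have n: "(T ^^ n) v \<in> S n" "\<And>k. k < n \<Longrightarrow> (T ^^ k) v \<notin> S k"
    unfolding n_def using ex not_less_Least by (auto intro: LeastI_ex)
  have "n \<noteq> 0"
    using n(1) assms(3) unfolding S_def by (cases n) (simp_all add: span_empty)
  then obtain m where m: "n = Suc m"
    using not0_implies_Suc by blast
  show thesis
    using n(1) n(2)[of m] unfolding m S_def by (intro that[of m]) simp_all
qed

end

section \<open>Lie's theorem over an algebraically closed field\<close>

locale alg_closed_vector_space = vector_space scale
  for scale :: "'a::{alg_closed_field, field_char_0} \<Rightarrow> 'b::ab_group_add \<Rightarrow> 'b" (infixr \<open>\<cdot>\<close> 75)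
begin

definition irreducible_under :: "('b \<Rightarrow> 'b) set \<Rightarrow> 'b set \<Rightarrow> bool" where
  "irreducible_under M U \<longleftrightarrow>
     subspace U \<and> U \<noteq> {0} \<and> (\<forall>A\<in>M. A ` U \<subseteq> U) \<and>
     (\<forall>W. subspace W \<longrightarrow> W \<subseteq> U \<longrightarrow> W \<noteq> {0} \<longrightarrow> (\<forall>A\<in>M. A ` W \<subseteq> W) \<longrightarrow> W = U)"

text \<open>
  An invariant subspace of least dimension is irreducible: a smaller invariant subspace would
  have smaller dimension.
\<close>

lemma irreducible_under_exists:
  assumes "subspace U" "U \<noteq> {0}" "U \<subseteq> span B" "finite B" "\<forall>A\<in>M. A ` U \<subseteq> U"
  obtains W where "irreducible_under M W" "W \<subseteq> U"
proof -
  define Q where "Q W \<longleftrightarrow> subspace W \<and> W \<subseteq> U \<and> W \<noteq> {0} \<and> (\<forall>A\<in>M. A ` W \<subseteq> W)" for W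
  have "Q U"
    using assms unfolding Q_def by simp
  then obtain W where W: "Q W" "\<And>X. Q X \<Longrightarrow> dim W \<le> dim X"
    using ex_has_least_nat[of Q U dim] by blast
  have "irreducible_under M W"
    unfolding irreducible_under_def
  proof (intro conjI allI impI)
    fix X assume X: "subspace X" "X \<subseteq> W" "X \<noteq> {0}" "\<forall>A\<in>M. A ` X \<subseteq> X"
    then have "Q X"
      using W(1) unfolding Q_def by blast
    then have "\<not> dim X < dim W"
      using W(2) by (simp add: not_less)
    then show "X = W"
      using dim_psubset_finite_span[OF X(1,2) _ _ assms(4)] W(1) assms(3) unfolding Q_def by blast
  qed (use W(1) in \<open>simp_all add: Q_def\<close>)
  then show thesis
    using that W(1) unfolding Q_def by blast
qed

abbreviation operator :: "('b \<Rightarrow> 'b) \<Rightarrow> bool" where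
  "operator T \<equiv> Vector_Spaces.linear scale scale T"

lemma operator_add: "operator T \<Longrightarrow> T (x + y) = T x + T y"
  unfolding Vector_Spaces.linear_iff by simp

lemma operator_scale: "operator T \<Longrightarrow> T (c \<cdot> x) = c \<cdot> T x"
  unfolding Vector_Spaces.linear_iff by simp

lemma operator_zero: "operator T \<Longrightarrow> T 0 = 0"
  using operator_scale[of T 0 0] by simp

lemma operator_diff: "operator T \<Longrightarrow> T (x - y) = T x - T y"
  using operator_add[of T "x - y" y] by (simp add: algebra_simps)

lemma operatorI: "(\<And>x y. T (x + y) = T x + T y) \<Longrightarrow> (\<And>c x. T (c \<cdot> x) = c \<cdot> T x) \<Longrightarrow> operator T"
  unfolding Vector_Spaces.linear_iff by (simp add: vector_space_axioms)

text \<open>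
  This is \<open>p(T) v\<close>. The recursion \<open>(a + X p)(T) v = a v + p(T) (T v)\<close> keeps \<open>p(T)\<close> a function of
  \<open>v\<close>, which is what is needed to peel a linear factor off \<open>p\<close>.
\<close>

definition poly_apply :: "('b \<Rightarrow> 'b) \<Rightarrow> 'a poly \<Rightarrow> 'b \<Rightarrow> 'b" where
  "poly_apply T p = fold_coeffs (\<lambda>a f v. a \<cdot> v + f (T v)) p (\<lambda>v. 0)"

lemma poly_apply_0 [simp]: "poly_apply T 0 v = 0"
  by (simp add: poly_apply_def)

lemma poly_apply_pCons [simp]: "poly_apply T (pCons a p) v = a \<cdot> v + poly_apply T p (T v)"
  by (cases "p = 0 \<and> a = 0") (auto simp: poly_apply_def fun_eq_iff)

lemma poly_apply_add: "poly_apply T (p + q) v = poly_apply T p v + poly_apply T q v"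
  by (induction p q arbitrary: v rule: poly_induct2) (simp_all add: algebra_simps)

lemma poly_apply_smult: "poly_apply T (smult c p) v = c \<cdot> poly_apply T p v"
  by (induction p arbitrary: v) (simp_all add: scale_right_distrib)

lemma poly_apply_diff: "operator T \<Longrightarrow> poly_apply T p (v - w) = poly_apply T p v - poly_apply T p w"
  by (induction p arbitrary: v w) (simp_all add: operator_diff scale_right_diff_distrib)

lemma poly_apply_scale: "operator T \<Longrightarrow> poly_apply T p (c \<cdot> v) = c \<cdot> poly_apply T p v"
  by (induction p arbitrary: v) (simp_all add: operator_scale scale_right_distrib mult.commute)

lemma poly_apply_linear_factor:
  assumes "operator T"
  shows "poly_apply T ([:- z, 1:] * q) v = poly_apply T q (T v - z \<cdot> v)"
proof -
  have "[:- z, 1:] * q = smult (- z) q + pCons 0 q"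
    by simp
  then show ?thesis
    using assms by (simp add: poly_apply_add poly_apply_smult poly_apply_diff poly_apply_scale
        del: mult_pCons_left smult_minus_left)
qed

text \<open>
  Write \<open>p = (X - z) q\<close>. Either \<open>v\<close> is itself an eigenvector for \<open>z\<close>, or \<open>T v - z v\<close> is a nonzero
  vector annihilated by \<open>q(T)\<close>, which has smaller degree.
\<close>

lemma eigenvector_of_annihilating_poly:
  assumes "operator T" "subspace U" "T ` U \<subseteq> U" "v \<in> U" "v \<noteq> 0" "p \<noteq> 0" "poly_apply T p v = 0"
  shows "\<exists>u\<in>U. u \<noteq> 0 \<and> (\<exists>z. T u = z \<cdot> u)"
  using assms(4-7)
proof (induction "degree p" arbitrary: p v)
  case 0
  then obtain c where c: "p = [:c:]"
    using degree_eq_zeroE by metis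
  with 0 show ?case
    by simp
next
  case (Suc n)
  then obtain z where "poly p z = 0"
    using alg_closed_imp_poly_has_root[of p] by auto
  then obtain q where q: "p = [:- z, 1:] * q"
    unfolding poly_eq_0_iff_dvd by (elim dvdE)
  have q0: "q \<noteq> 0"
    using q Suc.prems(3) by auto
  have deg: "degree q = n"
    using Suc.hyps(2) q0 unfolding q by (subst (asm) degree_mult_eq) auto
  show ?case
  proof (cases "T v - z \<cdot> v = 0")
    case True
    then show ?thesis
      using Suc.prems(1,2) by auto
  next
    case False
    have "T v - z \<cdot> v \<in> U"
      using Suc.prems(1) assms(2,3) by (auto intro!: subspace_diff subspace_scale)
    moreover have "poly_apply T q (T v - z \<cdot> v) = 0"
      using Suc.prems(4) unfolding q poly_apply_linear_factor[OF assms(1)] .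
    ultimately show ?thesis
      using Suc.hyps(1)[of q] deg False q0 by simp
  qed
qed

lemma poly_apply_monom: "poly_apply T (monom c n) v = c \<cdot> (T ^^ n) v"
  by (induction n arbitrary: v) (simp_all add: monom_0 monom_Suc funpow_swap1)

lemma in_span_iterates_poly_apply:
  assumes "w \<in> span ((\<lambda>i. (T ^^ i) v) ` {..<n})"
  shows "\<exists>q. w = poly_apply T q v \<and> (\<forall>k\<ge>n. coeff q k = 0)"
  using assms
proof (induction rule: span_induct_alt)
  case base
  show ?case
    by (intro exI[of _ 0]) simp
next
  case (step c x y)
  then obtain i q where i: "i < n" "x = (T ^^ i) v" and q: "y = poly_apply T q v" "\<forall>k\<ge>n. coeff q k = 0"
    by auto
  then show ?case
    by (intro exI[of _ "monom c i + q"]) (simp add: poly_apply_add poly_apply_monom)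
qed

lemma iterates_mem: "T ` U \<subseteq> U \<Longrightarrow> v \<in> U \<Longrightarrow> (T ^^ k) v \<in> U"
  by (induction k) auto

lemma eigenvector_exists:
  assumes "operator T" "subspace U" "T ` U \<subseteq> U" "U \<noteq> {0}" "U \<subseteq> span B" "finite B"
  shows "\<exists>u\<in>U. u \<noteq> 0 \<and> (\<exists>z. T u = z \<cdot> u)"
proof -
  obtain v where v: "v \<in> U" "v \<noteq> 0"
    using assms(2,4) subspace_0 by blast
  have "(T ^^ k) v \<in> span B" for k
    using iterates_mem[OF assms(3) v(1)] assms(5) by blast
  then obtain m where "(T ^^ Suc m) v \<in> span ((\<lambda>i. (T ^^ i) v) ` {..<Suc m})"
    using least_iterate_in_span[OF assms(6) _ v(2)] by metis
  from in_span_iterates_poly_apply[OF this] obtain q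
    where q: "(T ^^ Suc m) v = poly_apply T q v" "\<forall>k\<ge>Suc m. coeff q k = 0"
    by blast
  let ?p = "monom 1 (Suc m) + smult (-1) q"
  have "coeff ?p (Suc m) = 1"
    using q(2) by simp
  then have "?p \<noteq> 0"
    by (metis coeff_0 zero_neq_one)
  moreover have "poly_apply T ?p v = 0"
    unfolding poly_apply_add poly_apply_smult poly_apply_monom q(1) by simp
  ultimately show ?thesis
    using eigenvector_of_annihilating_poly[OF assms(1-3) v] by blast
qed

abbreviation commutator :: "('b \<Rightarrow> 'b) \<Rightarrow> ('b \<Rightarrow> 'b) \<Rightarrow> 'b \<Rightarrow> 'b" where
  "commutator A B \<equiv> (\<lambda>v. A (B v) - B (A v))"

text \<open>
  The powers of \<open>T\<close> turn \<open>v\<close> into a flag on which \<open>N\<close> acts by triangular operators, and a nonzero weight of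
  \<open>[h,T]\<close> would make this flag grow for ever.
  With \<open>S k\<close> the span of the \<open>T\<^sup>i v\<close> for \<open>i < k\<close>, induction shows that \<open>h T\<^sup>k\<^sup>+\<^sup>1 v\<close> is congruent to
  \<open>\<phi> h T\<^sup>k\<^sup>+\<^sup>1 v + (k + 1) \<phi> [h,T] T\<^sup>k v\<close> modulo \<open>S k\<close>.
  If \<open>m + 1\<close> is the first exponent with \<open>T\<^sup>m\<^sup>+\<^sup>1 v \<in> S (m + 1)\<close>, then \<open>h - \<phi> h\<close> also maps \<open>T\<^sup>m\<^sup>+\<^sup>1 v\<close>
  into \<open>S m\<close>, because it maps each earlier \<open>T\<^sup>i v\<close> into \<open>S i\<close>. So \<open>(m + 1) \<phi> [h,T] T\<^sup>m v \<in> S m\<close>, and as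
  \<open>T\<^sup>m v \<notin> S m\<close> and the characteristic is zero, \<open>\<phi> [h,T] = 0\<close>.
\<close>

lemma weight_commutator_zero:
  assumes T: "operator T" and N: "\<And>h. h \<in> N \<Longrightarrow> operator h"
    and cl: "\<And>h. h \<in> N \<Longrightarrow> commutator h T \<in> N"
    and wt: "\<And>h. h \<in> N \<Longrightarrow> h v = \<phi> h \<cdot> v"
    and v: "v \<noteq> 0" and B: "finite B" "\<And>k. (T ^^ k) v \<in> span B" and h: "h \<in> N"
  shows "\<phi> (commutator h T) = 0"
proof -
  define S where "S k = span ((\<lambda>i. (T ^^ i) v) ` {..<k})" for k
  obtain m where m: "(T ^^ Suc m) v \<in> S (Suc m)" "(T ^^ m) v \<notin> S m"
    using least_iterate_in_span[OF B v] unfolding S_def by metis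
  have S_mono: "i \<le> j \<Longrightarrow> S i \<subseteq> S j" for i j
    unfolding S_def by (intro span_mono image_mono) auto
  have S_sub: "subspace (S k)" for k
    unfolding S_def by simp
  have S_base: "i < k \<Longrightarrow> (T ^^ i) v \<in> S k" for i k
    unfolding S_def by (intro span_base) auto
  have S_T: "T w \<in> S (Suc k)" if "w \<in> S k" for w k
    using that unfolding S_def
  proof (induction rule: span_induct_alt)
    case base
    then show ?case
      by (simp add: operator_zero[OF T] span_zero)
  next
    case (step c x y)
    then obtain i where i: "i < k" "x = (T ^^ i) v"
      by auto
    then have "T x \<in> span ((\<lambda>i. (T ^^ i) v) ` {..<Suc k})"
      using S_base[of "Suc i" "Suc k"] unfolding S_def by simp
    with step show ?case
      by (simp add: operator_add[OF T] operator_scale[OF T] span_add span_scale)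
  qed
  have upper: "\<forall>h\<in>N. h ((T ^^ Suc k) v) - \<phi> h \<cdot> (T ^^ Suc k) v
      - (of_nat (Suc k) * \<phi> (commutator h T)) \<cdot> (T ^^ k) v \<in> S k" for k
  proof (induction k)
    case 0
    show ?case
    proof
      fix h assume h: "h \<in> N"
      have "h (T v) = T (h v) + commutator h T v"
        by simp
      also have "\<dots> = \<phi> h \<cdot> T v + \<phi> (commutator h T) \<cdot> v"
        using wt[OF h] wt[OF cl[OF h]] by (simp add: operator_scale[OF T])
      finally show "h ((T ^^ Suc 0) v) - \<phi> h \<cdot> (T ^^ Suc 0) v
          - (of_nat (Suc 0) * \<phi> (commutator h T)) \<cdot> (T ^^ 0) v \<in> S 0"
        using S_sub by (simp add: subspace_0)
    qed
  next
    case (Suc k)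
    show ?case
    proof
      fix h assume h: "h \<in> N"
      define c where "c = \<phi> (commutator h T)"
      define u where "u = (T ^^ k) v"
      define r where "r = h (T u) - \<phi> h \<cdot> T u - (of_nat (Suc k) * c) \<cdot> u"
      define r' where "r' = commutator h T (T u) - c \<cdot> T u
        - (of_nat (Suc k) * \<phi> (commutator (commutator h T) T)) \<cdot> u"
      have r: "r \<in> S k"
        using Suc.IH h unfolding r_def c_def u_def by simp
      have r': "r' \<in> S k"
        using bspec[OF Suc.IH cl[OF h]] unfolding r'_def c_def u_def by simp
      have u: "u \<in> S (Suc k)"
        unfolding u_def by (rule S_base) simp
      have h1: "h (T u) = r + \<phi> h \<cdot> T u + (of_nat (Suc k) * c) \<cdot> u"
        unfolding r_def by simp
      have c1: "h (T (T u)) - T (h (T u)) = r' + c \<cdot> T u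
          + (of_nat (Suc k) * \<phi> (commutator (commutator h T) T)) \<cdot> u"
        unfolding r'_def by simp
      have Suc2: "of_nat (Suc (Suc k)) * c = of_nat (Suc k) * c + c"
        by (simp add: algebra_simps)
      have T1: "T (h (T u)) = T r + \<phi> h \<cdot> T (T u) + (of_nat (Suc k) * c) \<cdot> T u"
        unfolding h1 by (simp add: operator_add[OF T] operator_scale[OF T])
      have "h (T (T u)) - \<phi> h \<cdot> T (T u) - (of_nat (Suc (Suc k)) * c) \<cdot> T u
          = T r + r' + (of_nat (Suc k) * \<phi> (commutator (commutator h T) T)) \<cdot> u"
        using c1 unfolding T1 Suc2 by (simp add: algebra_simps scale_left_distrib del: of_nat_Suc)
      also have "\<dots> \<in> S (Suc k)"
        using r r' u S_mono[of k "Suc k"] by (intro subspace_add subspace_scale S_sub S_T) auto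
      finally show "h ((T ^^ Suc (Suc k)) v) - \<phi> h \<cdot> (T ^^ Suc (Suc k)) v
          - (of_nat (Suc (Suc k)) * \<phi> (commutator h T)) \<cdot> (T ^^ Suc k) v \<in> S (Suc k)"
        unfolding u_def c_def by simp
    qed
  qed
  \<comment> \<open>for \<open>i = Suc k\<close> the term \<open>T\<^sup>k v\<close> of the refined congruence lies in \<open>S i\<close> and may be dropped\<close>
  have diag: "h ((T ^^ i) v) - \<phi> h \<cdot> (T ^^ i) v \<in> S i" for i
  proof (cases i)
    case 0
    then show ?thesis
      using wt[OF h] S_sub by (simp add: subspace_0)
  next
    case (Suc k)
    have "h ((T ^^ Suc k) v) - \<phi> h \<cdot> (T ^^ Suc k) v
      = (h ((T ^^ Suc k) v) - \<phi> h \<cdot> (T ^^ Suc k) v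
          - (of_nat (Suc k) * \<phi> (commutator h T)) \<cdot> (T ^^ k) v)
        + (of_nat (Suc k) * \<phi> (commutator h T)) \<cdot> (T ^^ k) v"
      by simp
    also have "\<dots> \<in> S (Suc k)"
      using upper[of k] h S_mono[of k "Suc k"] S_base[of k "Suc k"]
      by (intro subspace_add subspace_scale S_sub) auto
    finally show ?thesis
      unfolding Suc .
  qed
  have tri: "h w - \<phi> h \<cdot> w \<in> S m" if "w \<in> S (Suc m)" for w
    using that unfolding S_def[of "Suc m"]
  proof (induction rule: span_induct_alt)
    case base
    show ?case
      using S_sub by (simp add: operator_zero[OF N[OF h]] subspace_0)
  next
    case (step c x y)
    then obtain i where i: "i \<le> m" "x = (T ^^ i) v"
      by (auto simp: less_Suc_eq_le)
    have "h (c \<cdot> x + y) - \<phi> h \<cdot> (c \<cdot> x + y)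
        = c \<cdot> (h x - \<phi> h \<cdot> x) + (h y - \<phi> h \<cdot> y)"
      by (simp add: operator_add[OF N[OF h]] operator_scale[OF N[OF h]] algebra_simps)
    also have "\<dots> \<in> S m"
      using diag[of i] S_mono[OF i(1)] step.IH unfolding i(2)
      by (intro subspace_add subspace_scale S_sub) auto
    finally show ?case .
  qed
  define c where "c = of_nat (Suc m) * \<phi> (commutator h T)"
  \<comment> \<open>the two congruences for \<open>h T\<^sup>m\<^sup>+\<^sup>1 v\<close> modulo \<open>S m\<close>, one by dependence on its predecessors, one by \<open>upper\<close>, differ by this term\<close>
  have "(h ((T ^^ Suc m) v) - \<phi> h \<cdot> (T ^^ Suc m) v)
      - (h ((T ^^ Suc m) v) - \<phi> h \<cdot> (T ^^ Suc m) v - c \<cdot> (T ^^ m) v) \<in> S m"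
    using tri[OF m(1)] bspec[OF upper[of m] h] unfolding c_def by (rule subspace_diff[OF S_sub])
  then have "c \<cdot> (T ^^ m) v \<in> S m"
    by simp
  then have "c \<noteq> 0 \<Longrightarrow> inverse c \<cdot> c \<cdot> (T ^^ m) v \<in> S m"
    by (rule subspace_scale[OF S_sub])
  then have "c = 0"
    using m(2) by auto
  then show ?thesis
    unfolding c_def by (simp del: of_nat_Suc)
qed

text \<open>
  The vectors of weight \<open>\<phi>\<close> in \<open>U\<close> form a nonzero subspace. It is invariant under \<open>M\<close>, since
  \<open>h (T w) = T (h w) + [h,T] w\<close> and the weight of \<open>[h,T]\<close> vanishes; by irreducibility it is all of \<open>U\<close>.
\<close>

lemma weight_on_irreducible:
  assumes U: "irreducible_under M U" "U \<subseteq> span B" "finite B"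
    and M: "\<And>T. T \<in> M \<Longrightarrow> operator T" and N: "\<And>h. h \<in> N \<Longrightarrow> operator h"
    and cl: "\<And>h T. h \<in> N \<Longrightarrow> T \<in> M \<Longrightarrow> commutator h T \<in> N"
    and v: "v \<in> U" "v \<noteq> 0" and wt: "\<And>h. h \<in> N \<Longrightarrow> h v = \<phi> h \<cdot> v"
    and h: "h \<in> N" and u: "u \<in> U"
  shows "h u = \<phi> h \<cdot> u"
proof -
  define W where "W = {u \<in> U. \<forall>h\<in>N. h u = \<phi> h \<cdot> u}"
  have Us: "subspace U"
    and inv: "\<And>T u. T \<in> M \<Longrightarrow> u \<in> U \<Longrightarrow> T u \<in> U"
    and min: "\<And>W. subspace W \<Longrightarrow> W \<subseteq> U \<Longrightarrow> W \<noteq> {0} \<Longrightarrow> \<forall>A\<in>M. A ` W \<subseteq> W \<Longrightarrow> W = U"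
    using U(1) unfolding irreducible_under_def by blast+
  have "subspace W"
    using Us unfolding W_def subspace_def
    by (auto simp: operator_zero[OF N] operator_add[OF N] operator_scale[OF N] scale_right_distrib
        mult.commute)
  moreover have "T w \<in> W" if "T \<in> M" "w \<in> W" for T w
  proof -
    have w: "w \<in> U" and ww: "\<And>h. h \<in> N \<Longrightarrow> h w = \<phi> h \<cdot> w"
      using that(2) unfolding W_def by auto
    have "h (T w) = \<phi> h \<cdot> T w" if hN: "h \<in> N" for h
    proof (cases "w = 0")
      case True
      then show ?thesis
        by (simp add: operator_zero[OF N[OF hN]] operator_zero[OF M[OF \<open>T \<in> M\<close>]])
    next
      case False
      have "(T ^^ k) w \<in> span B" for k
        using iterates_mem[of T U w] inv[OF \<open>T \<in> M\<close>] w U(2) by blast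
      then have "\<phi> (commutator h T) = 0"
        using \<open>T \<in> M\<close> hN False U(3) by (intro weight_commutator_zero[of T N w]) (auto intro: M N cl ww)
      then have "commutator h T w = 0"
        using ww[OF cl[OF hN \<open>T \<in> M\<close>]] by simp
      then show ?thesis
        using ww[OF hN] by (simp add: operator_scale[OF M[OF \<open>T \<in> M\<close>]])
    qed
    then show ?thesis
      using inv[OF that(1) w] unfolding W_def by simp
  qed
  moreover have "v \<in> W"
    using v wt unfolding W_def by simp
  ultimately have "W = U"
    using min[of W] v(2) unfolding W_def by blast
  then show ?thesis
    using h u unfolding W_def by blast
qed

text \<open>
  Here \<open>M k\<close> plays the part of the operators coming from the \<open>k\<close>-th derived algebra.
  Descending from \<open>M K\<close>, suppose that \<open>M (n+1)\<close> has a common eigenvector in every invariant subspace, and restrict to a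
  subspace \<open>W\<close> irreducible under \<open>M n\<close>. Then \<open>M (n+1)\<close> acts on \<open>W\<close> by scalars. Any \<open>T \<in> M n\<close> has some
  eigenvector in \<open>W\<close>, which is therefore a common eigenvector of \<open>T\<close> and \<open>M (n+1)\<close>; as the set
  \<open>{T} \<union> M (n+1)\<close> is stable under commutators with \<open>M n\<close>, the operator \<open>T\<close> acts on \<open>W\<close> by a scalar too.
  Hence every nonzero vector of \<open>W\<close> is a common eigenvector.
\<close>

theorem lie_common_eigenvector:
  fixes M :: "nat \<Rightarrow> ('b \<Rightarrow> 'b) set"
  assumes lin: "\<And>k T. T \<in> M k \<Longrightarrow> operator T"
    and desc: "\<And>k. M (Suc k) \<subseteq> M k"
    and comm: "\<And>k A B. A \<in> M k \<Longrightarrow> B \<in> M k \<Longrightarrow> commutator A B \<in> M (Suc k)"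
    and triv: "M K \<subseteq> {\<lambda>v. 0}"
    and U: "subspace U" "U \<noteq> {0}" "U \<subseteq> span B" "finite B" "\<forall>T\<in>M k. T ` U \<subseteq> U" and k: "k \<le> K"
  shows "\<exists>v\<in>U. v \<noteq> 0 \<and> (\<forall>T\<in>M k. \<exists>z. T v = z \<cdot> v)"
  using k U(1-3,5)
proof (induction k arbitrary: U rule: inc_induct)
  case base
  then obtain v where v: "v \<in> U" "v \<noteq> 0"
    using subspace_0 by blast
  have "T v = 0 \<cdot> v" if "T \<in> M K" for T
    using triv that by auto
  then show ?case
    using v by blast
next
  case (step n)
  obtain W where W: "irreducible_under (M n) W" "W \<subseteq> U"
    using irreducible_under_exists[OF step.prems(1-3) U(4) step.prems(4)] by blast
  have Ws: "subspace W" "W \<noteq> {0}" "W \<subseteq> span B" and inv: "\<forall>T\<in>M n. T ` W \<subseteq> W"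
    using W step.prems(3) unfolding irreducible_under_def by auto
  obtain v where v: "v \<in> W" "v \<noteq> 0" and "\<forall>T\<in>M (Suc n). \<exists>z. T v = z \<cdot> v"
    using step.IH[OF Ws] inv desc by blast
  then obtain \<mu> where \<mu>: "\<forall>T\<in>M (Suc n). T v = \<mu> T \<cdot> v"
    by metis
  have scal: "h u = \<mu> h \<cdot> u" if "h \<in> M (Suc n)" "u \<in> W" for h u
  proof (rule weight_on_irreducible[OF W(1) Ws(3) U(4) lin lin _ v _ that])
    show "commutator h T \<in> M (Suc n)" if "h \<in> M (Suc n)" "T \<in> M n" for h T
      using that comm desc by blast
  qed (use \<mu> in simp_all)
  have "\<exists>z. T v = z \<cdot> v" if T: "T \<in> M n" for T
  proof -
    obtain w z where w: "w \<in> W" "w \<noteq> 0" "T w = z \<cdot> w"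
      using eigenvector_exists[OF lin[OF T] Ws(1) _ Ws(2,3) U(4)] inv T by blast
    have "\<exists>z. h w = z \<cdot> w" if "h \<in> insert T (M (Suc n))" for h
      using that w scal by blast
    then obtain \<nu> where \<nu>: "\<And>h. h \<in> insert T (M (Suc n)) \<Longrightarrow> h w = \<nu> h \<cdot> w"
      by metis
    have "T v = \<nu> T \<cdot> v"
    proof (rule weight_on_irreducible[where N = "insert T (M (Suc n))" and M = "M n"])
      show "irreducible_under (M n) W" "W \<subseteq> span B" "finite B"
        by (fact W(1) Ws(3) U(4))+
      show "operator h" if "h \<in> M n" for h
        using that by (rule lin)
      show "operator h" if "h \<in> insert T (M (Suc n))" for h
        using that lin T by blast
      show "commutator h S \<in> insert T (M (Suc n))" if "h \<in> insert T (M (Suc n))" "S \<in> M n" for h S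
        using that comm desc T by blast
      show "h w = \<nu> h \<cdot> w" if "h \<in> insert T (M (Suc n))" for h
        using that by (rule \<nu>)
    qed (use w v(1) in simp_all)
    then show ?thesis ..
  qed
  then show ?case
    using v W(2) by blast
qed

end

section \<open>Complexification and representation of functionals\<close>

text \<open>
  The complexification of a real vector space: the pair \<open>(v, w)\<close> stands for \<open>v + \<i> w\<close>.
\<close>

definition complex_pair_scale :: "complex \<Rightarrow> 'a::real_vector \<times> 'a \<Rightarrow> 'a \<times> 'a" where
  "complex_pair_scale z p =
     (Re z *\<^sub>R fst p - Im z *\<^sub>R snd p, Im z *\<^sub>R fst p + Re z *\<^sub>R snd p)"

interpretation cx: alg_closed_vector_space complex_pair_scale
  by unfold_locales (auto simp: complex_pair_scale_def prod_eq_iff algebra_simps)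

lemma complexification_finite_span:
  assumes "J \<subseteq> span B"
  shows "J \<times> J \<subseteq> cx.span ((\<lambda>x. (x, 0)) ` B)"
proof clarify
  have *: "(v, 0) \<in> cx.span ((\<lambda>x. (x, 0)) ` B)" if "v \<in> span B" for v
    using that
  proof (induction rule: span_induct_alt)
    case base
    show ?case
      using cx.span_zero by (simp add: zero_prod_def)
  next
    case (step c x y)
    have "(c *\<^sub>R x + y, 0) = complex_pair_scale (of_real c) (x, 0) + (y, 0)"
      by (simp add: complex_pair_scale_def)
    also have "\<dots> \<in> cx.span ((\<lambda>x. (x, 0)) ` B)"
      using step by (intro cx.span_add cx.span_scale) (auto intro: cx.span_base)
    finally show ?case .
  qed
  fix v w assume vw: "v \<in> J" "w \<in> J"
  have "(v, w) = (v, 0) + complex_pair_scale \<i> (w, 0)"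
    by (simp add: complex_pair_scale_def)
  also have "\<dots> \<in> cx.span ((\<lambda>x. (x, 0)) ` B)"
    using vw assms by (intro cx.span_add cx.span_scale *) auto
  finally show "(v, w) \<in> cx.span ((\<lambda>x. (x, 0)) ` B)" .
qed

text \<open>
  For a basis \<open>C\<close>, the endomorphism \<open>p \<mapsto> \<Sum>c\<in>C. \<omega>(p, c) c\<close> is injective by nondegeneracy, hence
  surjective. A preimage of \<open>\<Sum>c\<in>C. \<phi>(c) c\<close> represents \<open>\<phi>\<close>.
\<close>

lemma riesz_finite_span:
  fixes \<omega> :: "'a::real_vector \<Rightarrow> 'a \<Rightarrow> real" and \<phi> :: "'a \<Rightarrow> real"
  assumes V: "finite B" "span B = V" and \<omega>: "bilinear \<omega>"
    and nd: "\<And>x. x \<in> V \<Longrightarrow> \<forall>y\<in>V. \<omega> x y = 0 \<Longrightarrow> x = 0" and \<phi>: "linear \<phi>"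
  shows "\<exists>p\<in>V. \<forall>x\<in>V. \<omega> p x = \<phi> x"
proof -
  obtain C where C: "C \<subseteq> B" "independent C" "B \<subseteq> span C"
    by (rule maximal_independent_subset)
  have fC: "finite C"
    using C(1) V(1) by (rule finite_subset)
  have sC: "span C = V"
    using C(1,3) V(2) by (metis span_mono span_minimal subspace_span subset_antisym)
  define T where "T p = (\<Sum>c\<in>C. \<omega> p c *\<^sub>R c)" for p
  have lin: "linear T"
    unfolding T_def
    by (rule linearI)
       (simp_all add: bilinear_ladd[OF \<omega>] bilinear_lmul[OF \<omega>] scaleR_add_left sum.distrib scaleR_sum_right)
  have coeffs: "\<omega> p c = \<psi> c" if "T p = (\<Sum>c\<in>C. \<psi> c *\<^sub>R c)" "c \<in> C" for p \<psi> c
  proof -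
    have "(\<Sum>c\<in>C. (\<omega> p c - \<psi> c) *\<^sub>R c) = 0"
      using that(1) unfolding T_def by (simp add: scaleR_diff_left sum_subtractf)
    then have "\<omega> p c - \<psi> c = 0"
      using independentD[OF C(2) fC order_refl, of "\<lambda>c. \<omega> p c - \<psi> c"] that(2) by blast
    then show ?thesis
      by simp
  qed
  have ext: "\<omega> p x = \<psi> x" if "linear \<psi>" "\<And>c. c \<in> C \<Longrightarrow> \<omega> p c = \<psi> c" "x \<in> V" for p \<psi> x
  proof -
    have "linear (\<omega> p)"
      using \<omega> unfolding bilinear_def by blast
    then show ?thesis
      using linear_eq_on_span[of "\<omega> p" \<psi> C x] that sC by blast
  qed
  have "inj_on T (span C)"
  proof (rule inj_onI)
    fix p q assume pq: "p \<in> span C" "q \<in> span C" "T p = T q"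
    have "linear (\<lambda>x::'a. 0::real)"
      by (rule linearI) simp_all
    from ext[OF this] have "\<forall>x\<in>V. \<omega> (p - q) x = 0"
      using coeffs[of "p - q" "\<lambda>_. 0"] pq(3) by (simp add: linear_diff[OF lin])
    then have "p - q = 0"
      using nd pq(1,2) sC by (metis span_diff)
    then show "p = q"
      by simp
  qed
  then have ind: "independent (T ` C)" and card: "card (T ` C) = card C"
    by (simp_all add: linear_independent_injective_image[OF lin C(2)]
        card_image inj_on_subset[OF _ span_superset])
  have "T ` C \<subseteq> span C"
    unfolding T_def by (auto intro!: span_sum span_scale intro: span_base)
  then have "span C \<subseteq> span (T ` C)"
    using real_vector.span_subset_of_card_le[OF ind _ fC] card by simp
  moreover have "(\<Sum>c\<in>C. \<phi> c *\<^sub>R c) \<in> span C"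
    by (auto intro!: span_sum span_scale intro: span_base)
  ultimately have "(\<Sum>c\<in>C. \<phi> c *\<^sub>R c) \<in> T ` V"
    unfolding linear_span_image[OF lin] sC by (rule subsetD)
  then obtain p where p: "p \<in> V" "T p = (\<Sum>c\<in>C. \<phi> c *\<^sub>R c)"
    by (elim imageE) simp
  have "\<omega> p x = \<phi> x" if "x \<in> V" for x
    using coeffs[OF p(2)] that by (rule ext[OF \<phi>])
  then show ?thesis
    using p(1) by blast
qed

section \<open>Minimal ideals of solvable symplectic Lie algebras\<close>

text \<open>
  The identities hold on the whole ambient space and not just on \<open>V\<close>, which frees the calculations
  from membership conditions. Composing both arguments of a bracket and a form on \<open>V\<close> with a linear
  projection onto \<open>V\<close> brings any symplectic Lie algebra into this shape.
\<close>

locale symplectic_lie =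
  fixes V :: "'a::real_vector set" and b :: "'a \<Rightarrow> 'a \<Rightarrow> 'a" and \<omega> :: "'a \<Rightarrow> 'a \<Rightarrow> real"
  assumes V: "subspace V" and finite_span: "\<exists>B. finite B \<and> span B = V"
    and b: "bilinear b" and \<omega>: "bilinear \<omega>" and b_mem [simp]: "b x y \<in> V"
    and b_self [simp]: "b x x = 0"
    and jacobi: "b x (b y z) + b y (b z x) + b z (b x y) = 0"
    and skew: "\<omega> x y = - \<omega> y x"
    and nondegenerate: "x \<in> V \<Longrightarrow> \<forall>y\<in>V. \<omega> x y = 0 \<Longrightarrow> x = 0"
    and cocycle: "\<omega> (b x y) z + \<omega> (b y z) x + \<omega> (b z x) y = 0"
begin

abbreviation alg :: "'a symp_lie" where
  "alg \<equiv> \<lparr>sl_space = V, sl_bracket = b, sl_form = \<omega>\<rparr>"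

lemmas b_simps = bilinear_ladd[OF b] bilinear_radd[OF b] bilinear_lmul[OF b] bilinear_rmul[OF b]
  bilinear_lsub[OF b] bilinear_rsub[OF b] bilinear_lneg[OF b] bilinear_rneg[OF b]
  bilinear_lzero[OF b] bilinear_rzero[OF b]
lemmas \<omega>_simps = bilinear_ladd[OF \<omega>] bilinear_radd[OF \<omega>] bilinear_lmul[OF \<omega>] bilinear_rmul[OF \<omega>]
  bilinear_lsub[OF \<omega>] bilinear_rsub[OF \<omega>] bilinear_lneg[OF \<omega>] bilinear_rneg[OF \<omega>]
  bilinear_lzero[OF \<omega>] bilinear_rzero[OF \<omega>]

lemma b_skew: "b x y = - b y x"
proof -
  have "b (x + y) (x + y) = b x x + b x y + b y x + b y y"
    by (simp add: b_simps del: b_self)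
  then have "b x y + b y x = 0"
    by simp
  then show ?thesis
    by (rule eq_neg_iff_add_eq_0[THEN iffD2])
qed

lemma \<omega>_self [simp]: "\<omega> x x = 0"
  using skew[of x x] by simp

lemma b_b: "b (b x y) z = b x (b y z) - b y (b x z)"
  using jacobi[of x y z] b_skew[of z "b x y"] b_skew[of z x] by (simp add: b_simps algebra_simps)

lemma is_symplectic: "symplectic_lie_algebra alg"
proof -
  have "lie_algebra_on V b"
    unfolding lie_algebra_on_def bilinear_map_on_def linear_map_on_def
    by (simp add: V finite_span jacobi b_simps)
  moreover have "bilinear_map_on V UNIV \<omega>"
    unfolding bilinear_map_on_def linear_map_on_def by (simp add: \<omega>_simps)
  moreover have "\<forall>x\<in>V. \<forall>y\<in>V. \<omega> x y = - \<omega> y x"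
    by (intro ballI skew)
  moreover have "\<forall>x\<in>V. (\<forall>y\<in>V. \<omega> x y = 0) \<longrightarrow> x = 0"
    by (intro ballI impI, erule nondegenerate)
  moreover have "\<forall>x\<in>V. \<forall>y\<in>V. \<forall>z\<in>V. \<omega> (b x y) z + \<omega> (b y z) x + \<omega> (b z x) y = 0"
    by (intro ballI cocycle)
  ultimately show ?thesis
    unfolding symplectic_lie_algebra_def Let_def symp_lie.simps by (intro conjI)
qed

lemma derived_subset: "lie_derived_series alg (Suc k) \<subseteq> lie_derived_series alg k"
proof (induction k)
  case 0
  show ?case
    by (simp, intro span_minimal V) auto
next
  case (Suc k)
  have mono: "span {b x y |x y. x \<in> X \<and> y \<in> X} \<subseteq> span {b x y |x y. x \<in> Y \<and> y \<in> Y}"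
    if "X \<subseteq> Y" for X Y
    using that by (intro span_mono) blast
  show ?case
    using mono[OF Suc] by (simp only: lie_derived_series.simps(2) symp_lie.simps)
qed

lemma derived_bracket:
  "x \<in> lie_derived_series alg k \<Longrightarrow> y \<in> lie_derived_series alg k \<Longrightarrow> b x y \<in> lie_derived_series alg (Suc k)"
  by (auto intro!: span_base)

lemma riesz: "linear \<phi> \<Longrightarrow> \<exists>p\<in>V. \<forall>x\<in>V. \<omega> p x = \<phi> x"
  using riesz_finite_span[OF _ _ \<omega> nondegenerate] finite_span by blast

text \<open>
  Lie's theorem for the complexification \<open>J \<times> J\<close> of \<open>J\<close>: the equations are the real and imaginary
  parts of \<open>[x, v + \<i> w] = (\<alpha> + \<i> \<beta>) (v + \<i> w)\<close>.
\<close>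

lemma common_eigenvector_in_ideal:
  assumes solv: "lie_solvable alg" and J: "lie_ideal alg J" "J \<noteq> {0}"
  shows "\<exists>v\<in>J. \<exists>w\<in>J. (v, w) \<noteq> (0, 0) \<and>
    (\<forall>x\<in>V. \<exists>\<alpha> \<beta>. b x v = \<alpha> *\<^sub>R v - \<beta> *\<^sub>R w \<and> b x w = \<beta> *\<^sub>R v + \<alpha> *\<^sub>R w)"
proof -
  have Js: "subspace J" "J \<subseteq> V" and Jb: "\<And>x y. x \<in> V \<Longrightarrow> y \<in> J \<Longrightarrow> b x y \<in> J"
    using J(1) unfolding lie_ideal_def by auto
  obtain K where K: "lie_derived_series alg K = {0}"
    using solv unfolding lie_solvable_def by blast
  obtain B where B: "finite B" "span B = V"
    using finite_span by blast
  define \<rho> :: "'a \<Rightarrow> 'a \<times> 'a \<Rightarrow> 'a \<times> 'a" where "\<rho> x = (\<lambda>p. (b x (fst p), b x (snd p)))" for x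
  define M where "M k = \<rho> ` lie_derived_series alg k" for k
  have "\<exists>p\<in>J \<times> J. p \<noteq> 0 \<and> (\<forall>T\<in>M 0. \<exists>z. T p = complex_pair_scale z p)"
  proof (rule cx.lie_common_eigenvector[of M K, where B = "(\<lambda>x. (x, 0)) ` B"])
    show "cx.operator T" if "T \<in> M k" for k T
      using that unfolding M_def \<rho>_def
      by (auto intro!: cx.operatorI simp: b_simps complex_pair_scale_def)
    show "M (Suc k) \<subseteq> M k" for k
      unfolding M_def by (intro image_mono derived_subset)
    show "(\<lambda>v. A (C v) - C (A v)) \<in> M (Suc k)" if AC: "A \<in> M k" "C \<in> M k" for k A C
    proof -
      obtain x y where xy: "A = \<rho> x" "C = \<rho> y" "x \<in> lie_derived_series alg k" "y \<in> lie_derived_series alg k"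
        using AC unfolding M_def by blast
      have "(\<lambda>v. A (C v) - C (A v)) = \<rho> (b x y)"
        unfolding xy \<rho>_def by (simp add: b_b)
      then show ?thesis
        unfolding M_def using derived_bracket xy(3,4) by blast
    qed
    show "M K \<subseteq> {\<lambda>v. 0}"
      unfolding M_def K \<rho>_def by (simp add: b_simps zero_prod_def)
    show "cx.subspace (J \<times> J)"
      using Js(1) unfolding cx.subspace_def
      by (auto simp: complex_pair_scale_def zero_prod_def subspace_0 subspace_add subspace_diff subspace_scale)
    show "J \<times> J \<noteq> {0}"
    proof -
      obtain x where "x \<in> J" "x \<noteq> 0"
        using J(2) Js(1) subspace_0 by blast
      then have "(x, x) \<in> J \<times> J" "(x, x) \<noteq> 0"
        by (simp_all add: zero_prod_def)
      then show ?thesis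
        by blast
    qed
    show "J \<times> J \<subseteq> cx.span ((\<lambda>x. (x, 0)) ` B)"
      using complexification_finite_span Js(2) B(2) by blast
    show "\<forall>T\<in>M 0. T ` (J \<times> J) \<subseteq> J \<times> J"
      unfolding M_def \<rho>_def using Jb by auto
  qed (use B in auto)
  then obtain v w where vw: "v \<in> J" "w \<in> J" "(v, w) \<noteq> (0, 0)"
    and ev: "\<forall>T\<in>M 0. \<exists>z. T (v, w) = complex_pair_scale z (v, w)"
    by (auto simp: zero_prod_def)
  have "\<exists>\<alpha> \<beta>. b x v = \<alpha> *\<^sub>R v - \<beta> *\<^sub>R w \<and> b x w = \<beta> *\<^sub>R v + \<alpha> *\<^sub>R w" if "x \<in> V" for x
  proof -
    have "\<rho> x \<in> M 0"
      unfolding M_def using that by simp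
    then obtain z where "\<rho> x (v, w) = complex_pair_scale z (v, w)"
      using ev by blast
    then show ?thesis
      unfolding \<rho>_def complex_pair_scale_def by auto
  qed
  then show ?thesis
    using vw by blast
qed

text \<open>
  The real and imaginary parts of a complex eigenvector \<open>v + \<i> w\<close> span an invariant line if they
  are proportional, and an invariant plane otherwise. The basis \<open>v, - w\<close> gives the signs of the
  bracket relations in a double extension by a plane.
\<close>

lemma minimal_ideal_in_ideal:
  assumes "lie_solvable alg" and J: "lie_ideal alg J" "J \<noteq> {0}"
  obtains (line) e where "e \<in> J" "e \<noteq> 0" "\<And>x. x \<in> V \<Longrightarrow> \<exists>c. b x e = c *\<^sub>R e"
  | (plane) e0 e1 where "e0 \<in> J" "e1 \<in> J" "independent {e0, e1}" "e0 \<noteq> e1"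
      "\<And>x. x \<in> V \<Longrightarrow> \<exists>\<alpha> \<beta>. b x e0 = \<alpha> *\<^sub>R e0 + \<beta> *\<^sub>R e1 \<and> b x e1 = - \<beta> *\<^sub>R e0 + \<alpha> *\<^sub>R e1"
proof -
  obtain v w where vw: "v \<in> J" "w \<in> J" "(v, w) \<noteq> (0, 0)"
    and act: "\<And>x. x \<in> V \<Longrightarrow> \<exists>\<alpha> \<beta>. b x v = \<alpha> *\<^sub>R v - \<beta> *\<^sub>R w \<and> b x w = \<beta> *\<^sub>R v + \<alpha> *\<^sub>R w"
    using common_eigenvector_in_ideal[OF assms] by blast
  have neg: "- w \<in> J"
    using vw(2) J(1) unfolding lie_ideal_def by (auto intro: subspace_neg)
  consider "v = 0" | "v \<noteq> 0" "- w \<in> span {v}" | "v \<noteq> 0" "- w \<notin> span {v}"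
    by blast
  then show thesis
  proof cases
    case 1
    show thesis
    proof (rule line[of w])
      show "\<exists>c. b x w = c *\<^sub>R w" if "x \<in> V" for x
        using act[OF that] 1 by auto
    qed (use vw 1 in auto)
  next
    case 2
    then obtain k where "- w = k *\<^sub>R v"
      by (auto simp: span_singleton)
    then have k: "w = (- k) *\<^sub>R v"
      by (metis minus_minus scaleR_minus_left)
    show thesis
    proof (rule line[of v])
      show "\<exists>c. b x v = c *\<^sub>R v" if x: "x \<in> V" for x
      proof -
        obtain \<alpha> \<beta> where "b x v = \<alpha> *\<^sub>R v - \<beta> *\<^sub>R w"
          using act[OF x] by blast
        then have "b x v = (\<alpha> + \<beta> * k) *\<^sub>R v"
          unfolding k by (simp add: algebra_simps)
        then show ?thesis ..
      qed
    qed (use vw 2 in auto)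
  next
    case 3
    show thesis
    proof (rule plane[of v "- w"])
      have "independent (insert (- w) {v})"
        using 3 by (intro independent_insertI) (auto simp: independent_insert independent_empty)
      then show "independent {v, - w}"
        by (simp add: insert_commute)
      show "v \<noteq> - w"
        using 3(2) span_base by force
      show "\<exists>\<alpha> \<beta>. b x v = \<alpha> *\<^sub>R v + \<beta> *\<^sub>R - w \<and> b x (- w) = - \<beta> *\<^sub>R v + \<alpha> *\<^sub>R - w"
        if x: "x \<in> V" for x
      proof -
        obtain \<alpha> \<beta> where "b x v = \<alpha> *\<^sub>R v - \<beta> *\<^sub>R w" "b x w = \<beta> *\<^sub>R v + \<alpha> *\<^sub>R w"
          using act[OF x] by blast
        then show ?thesis
          by (intro exI[of _ \<alpha>] exI[of _ \<beta>]) (simp add: b_simps)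
      qed
    qed (use vw neg in auto)
  qed
qed

end

section \<open>Symplectic reduction by an isotropic ideal\<close>

lemma symplectic_transport:
  fixes f :: "'a::real_vector \<Rightarrow> 'b::real_vector"
  assumes g: "symplectic_lie_algebra \<gg>" and f: "linear f" "inj_on f (sl_space \<gg>)"
    and h: "sl_space \<hh> = f ` sl_space \<gg>"
    and br: "\<And>x y. x \<in> sl_space \<gg> \<Longrightarrow> y \<in> sl_space \<gg> \<Longrightarrow>
      f (sl_bracket \<gg> x y) = sl_bracket \<hh> (f x) (f y)"
    and fo: "\<And>x y. x \<in> sl_space \<gg> \<Longrightarrow> y \<in> sl_space \<gg> \<Longrightarrow>
      sl_form \<hh> (f x) (f y) = sl_form \<gg> x y"
  shows "symplectic_lie_algebra \<hh>" and "symp_lie_isomorphic \<gg> \<hh>"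
proof -
  show "symp_lie_isomorphic \<gg> \<hh>"
    unfolding symp_lie_isomorphic_def
  proof (intro exI[of _ f] conjI)
    show "linear_map_on (sl_space \<gg>) (sl_space \<hh>) f"
      unfolding linear_map_on_def h by (simp add: linear_add[OF f(1)] linear_scale[OF f(1)])
    show "bij_betw f (sl_space \<gg>) (sl_space \<hh>)"
      unfolding bij_betw_def h using f(2) by simp
  qed (use br fo in auto)
  let ?V = "sl_space \<gg>" and ?b = "sl_bracket \<gg>" and ?w = "sl_form \<gg>"
  have L: "lie_algebra_on ?V ?b" and bw: "bilinear_map_on ?V UNIV ?w"
    and sk: "\<forall>x\<in>?V. \<forall>y\<in>?V. ?w x y = - ?w y x"
    and nd: "\<forall>x\<in>?V. (\<forall>y\<in>?V. ?w x y = 0) \<longrightarrow> x = 0"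
    and co: "\<forall>x\<in>?V. \<forall>y\<in>?V. \<forall>z\<in>?V. ?w (?b x y) z + ?w (?b y z) x + ?w (?b z x) y = 0"
    using g unfolding symplectic_lie_algebra_def Let_def by - (elim conjE, assumption)+
  have V: "subspace ?V" and fin: "\<exists>B. finite B \<and> span B = ?V" and bb: "bilinear_map_on ?V ?V ?b"
    and alt: "\<forall>x\<in>?V. ?b x x = 0"
    and jac: "\<forall>x\<in>?V. \<forall>y\<in>?V. \<forall>z\<in>?V. ?b x (?b y z) + ?b y (?b z x) + ?b z (?b x y) = 0"
    using L unfolding lie_algebra_on_def by - (elim conjE, assumption)+
  have mem: "?b x y \<in> ?V" if "x \<in> ?V" "y \<in> ?V" for x y
    using bb that unfolding bilinear_map_on_def linear_map_on_def by blast
  note [simp] = linear_add[OF f(1), symmetric] linear_scale[OF f(1), symmetric] br[symmetric] fo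
    subspace_add[OF V] subspace_scale[OF V] mem
  have "lie_algebra_on (sl_space \<hh>) (sl_bracket \<hh>)"
    unfolding lie_algebra_on_def
  proof (intro conjI)
    show "subspace (sl_space \<hh>)"
      unfolding h using f(1) V by (rule linear_subspace_image)
    obtain B where "finite B" "span B = ?V"
      using fin by blast
    then show "\<exists>B. finite B \<and> span B = sl_space \<hh>"
      unfolding h using linear_span_image[OF f(1), of B] by (intro exI[of _ "f ` B"]) simp
    show "bilinear_map_on (sl_space \<hh>) (sl_space \<hh>) (sl_bracket \<hh>)"
      using bb unfolding h bilinear_map_on_def linear_map_on_def ball_simps by simp
    show "\<forall>x\<in>sl_space \<hh>. sl_bracket \<hh> x x = 0"
      unfolding h ball_simps using alt linear_0[OF f(1)] by simp
    show "\<forall>x\<in>sl_space \<hh>. \<forall>y\<in>sl_space \<hh>. \<forall>z\<in>sl_space \<hh>. sl_bracket \<hh> x (sl_bracket \<hh> y z)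
        + sl_bracket \<hh> y (sl_bracket \<hh> z x) + sl_bracket \<hh> z (sl_bracket \<hh> x y) = 0"
      unfolding h ball_simps using jac linear_0[OF f(1)] by simp
  qed
  moreover have "bilinear_map_on (sl_space \<hh>) UNIV (sl_form \<hh>)"
    using bw unfolding h bilinear_map_on_def linear_map_on_def ball_simps by simp
  moreover have "\<forall>x\<in>sl_space \<hh>. \<forall>y\<in>sl_space \<hh>. sl_form \<hh> x y = - sl_form \<hh> y x"
  proof -
    have "sl_form \<hh> (f x) (f y) = - sl_form \<hh> (f y) (f x)" if "x \<in> ?V" "y \<in> ?V" for x y
      using bspec[OF bspec[OF sk that(1)] that(2)] that fo by metis
    then show ?thesis
      unfolding h ball_simps by (intro ballI)
  qed
  moreover have "\<forall>x\<in>sl_space \<hh>. (\<forall>y\<in>sl_space \<hh>. sl_form \<hh> x y = 0) \<longrightarrow> x = 0"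
  proof -
    have "f x = 0" if "x \<in> ?V" "\<forall>y\<in>?V. sl_form \<hh> (f x) (f y) = 0" for x
    proof -
      have "\<forall>y\<in>?V. ?w x y = 0"
        using that by simp
      then have "x = 0"
        using nd that(1) by blast
      then show ?thesis
        using linear_0[OF f(1)] by simp
    qed
    then show ?thesis
      unfolding h ball_simps by blast
  qed
  moreover have "\<forall>x\<in>sl_space \<hh>. \<forall>y\<in>sl_space \<hh>. \<forall>z\<in>sl_space \<hh>. sl_form \<hh> (sl_bracket \<hh> x y) z
      + sl_form \<hh> (sl_bracket \<hh> y z) x + sl_form \<hh> (sl_bracket \<hh> z x) y = 0"
    unfolding h ball_simps using co by simp
  ultimately show "symplectic_lie_algebra \<hh>"
    unfolding symplectic_lie_algebra_def Let_def by (intro conjI)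
qed

text \<open>
  This describes the situation of an isotropic ideal \<open>I\<close>, a complement \<open>A\<close> of \<open>I\<close> in its orthogonal
  space, and the projection \<open>pr\<close> onto \<open>A\<close> along a complement orthogonal to \<open>A\<close>. The quotient of the orthogonal space of \<open>I\<close> by \<open>I\<close> is
  a symplectic Lie algebra; carrying its structure over to \<open>A\<close> keeps it in the same ambient space.
\<close>

locale symplectic_reduction = symplectic_lie V b \<omega>
  for V :: "'a::real_vector set" and b \<omega> +
  fixes I A :: "'a set" and pr :: "'a \<Rightarrow> 'a"
  assumes A: "subspace A" "A \<subseteq> V" and pr: "linear pr"
    and pr_mem: "x \<in> V \<Longrightarrow> pr x \<in> A" and pr_id: "x \<in> A \<Longrightarrow> pr x = x"
    and pr_I: "y \<in> I \<Longrightarrow> pr y = 0" and ideal: "x \<in> V \<Longrightarrow> y \<in> I \<Longrightarrow> b x y \<in> I"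
    and perp: "x \<in> A \<Longrightarrow> y \<in> I \<Longrightarrow> \<omega> x y = 0"
    and perp_decomp: "w \<in> V \<Longrightarrow> \<forall>y\<in>I. \<omega> w y = 0 \<Longrightarrow> w - pr w \<in> I"
    and pr_adj: "v \<in> V \<Longrightarrow> x \<in> A \<Longrightarrow> \<omega> (pr v) x = \<omega> v x"
begin

abbreviation reduced :: "'a symp_lie" where
  "reduced \<equiv> \<lparr>sl_space = A, sl_bracket = (\<lambda>x y. pr (b x y)), sl_form = \<omega>\<rparr>"

lemma A_mem: "x \<in> A \<Longrightarrow> x \<in> V"
  using A(2) by blast

text \<open>
  The orthogonal space of an ideal is a subalgebra, by the cocycle identity.
\<close>

lemma perp_bracket:
  assumes "x \<in> V" "y \<in> V" "e \<in> I" "\<forall>e\<in>I. \<omega> x e = 0" "\<forall>e\<in>I. \<omega> y e = 0"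
  shows "\<omega> (b x y) e = 0"
proof -
  have "\<omega> (b y e) x = 0" "\<omega> (b e x) y = 0"
    using assms ideal skew[of "b y e" x] skew[of "b x e" y] b_skew[of e x] by (simp_all add: \<omega>_simps)
  then show ?thesis
    using cocycle[of x y e] by simp
qed

lemma pr_bracket_cong:
  assumes "x \<in> V" "w - w' \<in> I"
  shows "pr (b x w) = pr (b x w')"
proof -
  have "pr (b x (w - w')) = 0"
    using assms by (intro pr_I ideal)
  then show ?thesis
    by (simp add: b_simps linear_diff[OF pr])
qed

lemma bracket_decomp: "x \<in> A \<Longrightarrow> y \<in> A \<Longrightarrow> b x y - pr (b x y) \<in> I"
  using perp_bracket A_mem perp by (intro perp_decomp) auto

lemma pr_b_pr: "x \<in> A \<Longrightarrow> y \<in> A \<Longrightarrow> z \<in> A \<Longrightarrow> pr (b x (pr (b y z))) = pr (b x (b y z))"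
  using pr_bracket_cong[OF A_mem bracket_decomp] by metis

lemma pr_image: "pr ` V = A"
proof
  show "pr ` V \<subseteq> A"
    using pr_mem by blast
  show "A \<subseteq> pr ` V"
    using pr_id A_mem by force
qed

text \<open>
  Elements of \<open>V\<close> pair with \<open>A\<close> through their projections, so nondegeneracy and the cocycle identity
  pass to \<open>A\<close>. For the Jacobi identity the inner projection may be dropped, since it changes a
  bracket of elements of \<open>A\<close> only by an element of the ideal \<open>I\<close>.
\<close>

lemma reduced_symplectic: "symplectic_lie_algebra reduced"
proof -
  have "lie_algebra_on A (\<lambda>x y. pr (b x y))"
    unfolding lie_algebra_on_def
  proof (intro conjI ballI)
    show "subspace A"
      by (fact A)
    obtain B where "finite B" "span B = V"
      using finite_span by blast
    then show "\<exists>B. finite B \<and> span B = A"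
      using linear_span_image[OF pr, of B] pr_image by (intro exI[of _ "pr ` B"]) simp
    show "bilinear_map_on A A (\<lambda>x y. pr (b x y))"
      unfolding bilinear_map_on_def linear_map_on_def
      by (simp add: pr_mem b_simps linear_add[OF pr] linear_scale[OF pr])
    show "pr (b x x) = 0" for x
      by (simp add: linear_0[OF pr])
    show "pr (b x (pr (b y z))) + pr (b y (pr (b z x))) + pr (b z (pr (b x y))) = 0"
      if "x \<in> A" "y \<in> A" "z \<in> A" for x y z
      using that jacobi[of x y z] by (simp add: pr_b_pr linear_0[OF pr] flip: linear_add[OF pr])
  qed
  moreover have "bilinear_map_on A UNIV \<omega>"
    unfolding bilinear_map_on_def linear_map_on_def by (simp add: \<omega>_simps)
  moreover have "\<forall>x\<in>A. \<forall>y\<in>A. \<omega> x y = - \<omega> y x"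
    by (intro ballI skew)
  moreover have "\<forall>x\<in>A. (\<forall>y\<in>A. \<omega> x y = 0) \<longrightarrow> x = 0"
  proof (intro ballI impI)
    fix x assume x: "x \<in> A" "\<forall>y\<in>A. \<omega> x y = 0"
    have "\<omega> x v = 0" if "v \<in> V" for v
      using pr_adj[OF that x(1)] bspec[OF x(2) pr_mem[OF that]] skew[of x v] skew[of x "pr v"] by simp
    then show "x = 0"
      using nondegenerate A_mem[OF x(1)] by blast
  qed
  moreover have "\<forall>x\<in>A. \<forall>y\<in>A. \<forall>z\<in>A. \<omega> (pr (b x y)) z + \<omega> (pr (b y z)) x + \<omega> (pr (b z x)) y = 0"
    by (simp add: pr_adj cocycle)
  ultimately show ?thesis
    unfolding symplectic_lie_algebra_def Let_def symp_lie.simps by (intro conjI)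
qed

text \<open>
  Modulo \<open>I\<close>, the reduced bracket of elements of \<open>A\<close> is their bracket in the orthogonal space of \<open>I\<close>. The
  derived series of a quotient of a subalgebra is contained in the image of the derived series of
  the whole algebra. The orthogonality condition has to be carried along, because only there do
  elements differ from their projections by elements of \<open>I\<close>.
\<close>

lemma reduced_derived:
  "lie_derived_series reduced k
    \<subseteq> pr ` (lie_derived_series alg k \<inter> {w \<in> V. \<forall>e\<in>I. \<omega> w e = 0})"
proof (induction k)
  case 0
  show ?case
    using A_mem perp pr_id by (auto intro!: rev_image_eqI)
next
  case (Suc k)
  let ?P = "{w \<in> V. \<forall>e\<in>I. \<omega> w e = 0}"
  have "subspace ?P"
    using V unfolding subspace_def by (auto simp: \<omega>_simps)
  moreover have "subspace (lie_derived_series alg (Suc k))"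
    by simp
  ultimately have "subspace (pr ` (lie_derived_series alg (Suc k) \<inter> ?P))"
    by (intro linear_subspace_image[OF pr] subspace_inter)
  moreover have "pr (b x y) \<in> pr ` (lie_derived_series alg (Suc k) \<inter> ?P)"
    if xy: "x \<in> lie_derived_series reduced k" "y \<in> lie_derived_series reduced k" for x y
  proof -
    obtain x' where x': "x = pr x'" "x' \<in> lie_derived_series alg k" "x' \<in> V" "\<forall>e\<in>I. \<omega> x' e = 0"
      using subsetD[OF Suc xy(1)] by blast
    obtain y' where y': "y = pr y'" "y' \<in> lie_derived_series alg k" "y' \<in> V" "\<forall>e\<in>I. \<omega> y' e = 0"
      using subsetD[OF Suc xy(2)] by blast
    have xV: "x \<in> V"
      using x'(1,3) pr_mem A_mem by simp
    have "pr (b x y) = pr (b x y')"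
      using pr_bracket_cong[OF xV perp_decomp[OF y'(3,4)]] y'(1) by simp
    also have "\<dots> = - pr (b y' x)"
      using b_skew[of x y'] by (simp add: linear_neg[OF pr])
    also have "\<dots> = - pr (b y' x')"
      using pr_bracket_cong[OF y'(3) perp_decomp[OF x'(3,4)]] x'(1) by simp
    also have "\<dots> = pr (b x' y')"
      using b_skew[of x' y'] by (simp add: linear_neg[OF pr])
    finally have eq: "pr (b x y) = pr (b x' y')" .
    have "b x' y' \<in> lie_derived_series alg (Suc k) \<inter> ?P"
      using derived_bracket[OF x'(2) y'(2)] perp_bracket[OF x'(3) y'(3) _ x'(4) y'(4)]
      by (simp del: lie_derived_series.simps)
    then show ?thesis
      unfolding eq by (rule imageI)
  qed
  ultimately have "span {pr (b x y) |x y. x \<in> lie_derived_series reduced k \<and> y \<in> lie_derived_series reduced k}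
      \<subseteq> pr ` (lie_derived_series alg (Suc k) \<inter> ?P)"
    by (intro span_minimal) auto
  then show ?case
    unfolding lie_derived_series.simps(2)[of reduced] by simp
qed

lemma reduced_solvable:
  assumes "lie_solvable alg"
  shows "lie_solvable reduced"
proof -
  obtain K where K: "lie_derived_series alg K = {0}"
    using assms unfolding lie_solvable_def by blast
  have "lie_derived_series reduced K \<subseteq> {0}"
    using reduced_derived[of K] unfolding K by (auto simp: linear_0[OF pr])
  moreover have "0 \<in> lie_derived_series reduced K"
    using A(1) by (cases K) (simp_all add: subspace_0 span_zero)
  ultimately have "lie_derived_series reduced K = {0}"
    by blast
  then show ?thesis
    unfolding lie_solvable_def ..
qed

lemma riesz_on_A:
  assumes "linear \<phi>"
  shows "\<exists>p\<in>A. \<forall>x\<in>A. \<omega> p x = \<phi> x"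
proof -
  obtain p where "p \<in> V" "\<forall>x\<in>V. \<omega> p x = \<phi> x"
    using riesz[OF assms] by blast
  then show ?thesis
    using pr_mem pr_adj A_mem by (intro bexI[of _ "pr p"]) auto
qed

end

section \<open>Reduction by an invariant line\<close>

context symplectic_lie
begin

lemma linear_\<omega>: "linear (\<omega> x)"
  using \<omega> unfolding bilinear_def by auto

lemma linear_b: "linear (b x)" "linear (\<lambda>x. b x y)"
  using b unfolding bilinear_def by auto

text \<open>
  Choose \<open>d\<close> with \<open>\<omega> d e = 1\<close> and let \<open>A\<close> be the orthogonal space of \<open>d\<close> and \<open>e\<close>. Write the bracket in
  the coordinates of \<open>d\<close>, \<open>A\<close> and \<open>e\<close>: the coordinate of \<open>v\<close> along \<open>d\<close> is \<open>\<omega> v e\<close>, the one along \<open>e\<close> is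
  \<open>\<omega> d v\<close>. The functionals occurring in the brackets with \<open>d\<close> and \<open>e\<close> are represented by \<open>p\<close> and \<open>q\<close>, and
  the cocycle identity forces the remaining coordinates to be those of a double extension by a line.
\<close>

lemma invariant_line_reduction:
  assumes solv: "lie_solvable alg" and e: "e \<in> V" "e \<noteq> 0" "\<And>x. x \<in> V \<Longrightarrow> \<exists>c. b x e = c *\<^sub>R e"
  shows "\<exists>\<aa> \<hh>. symplectic_lie_algebra \<aa> \<and> lie_solvable \<aa> \<and> subspace (sl_space \<aa>) \<and> sl_space \<aa> \<subset> V \<and>
    is_line_double_extension \<aa> \<hh> \<and> symp_lie_isomorphic alg \<hh>"
proof -
  obtain y where y: "y \<in> V" "\<omega> y e \<noteq> 0"
    using nondegenerate[OF e(1)] e(2) skew[of e] by force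
  define d where "d = (1 / \<omega> y e) *\<^sub>R y"
  have d: "d \<in> V" "\<omega> d e = 1" "\<omega> e d = -1"
    using y skew[of e d] by (simp_all add: d_def \<omega>_simps subspace_scale[OF V])
  define A where "A = {x \<in> V. \<omega> x d = 0 \<and> \<omega> x e = 0}"
  define pr where "pr v = v - \<omega> v e *\<^sub>R d - \<omega> d v *\<^sub>R e" for v
  have pr: "linear pr"
    unfolding pr_def by (rule linearI) (simp_all add: \<omega>_simps algebra_simps)
  have Ax: "x \<in> V" "\<omega> x d = 0" "\<omega> x e = 0" "\<omega> d x = 0" "\<omega> e x = 0" "pr x = x" if "x \<in> A" for x
    using that skew[of d x] skew[of e x] unfolding A_def pr_def by auto
  have pr_de: "pr d = 0" "pr e = 0"
    unfolding pr_def using d by simp_all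
  interpret symplectic_reduction V b \<omega> "span {e}" A pr
  proof (intro symplectic_reduction.intro symplectic_reduction_axioms.intro)
    show "symplectic_lie V b \<omega>"
      by (fact symplectic_lie_axioms)
    show "subspace A"
      using V unfolding A_def subspace_def by (auto simp: \<omega>_simps)
    show "A \<subseteq> V"
      unfolding A_def by blast
    show "linear pr"
      by (fact pr)
    show "pr x \<in> A" if "x \<in> V" for x
      unfolding A_def pr_def using that d e(1) V skew[of x d]
      by (simp add: \<omega>_simps subspace_diff subspace_scale)
    show "pr x = x" if "x \<in> A" for x
      using Ax[OF that] by simp
    show "pr y = 0" if "y \<in> span {e}" for y
      using that pr_de by (auto simp: span_singleton linear_scale[OF pr])
    show "b x y \<in> span {e}" if x: "x \<in> V" and y: "y \<in> span {e}" for x y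
    proof -
      obtain k where "y = k *\<^sub>R e"
        using y by (auto simp: span_singleton)
      moreover obtain c where "b x e = c *\<^sub>R e"
        using e(3)[OF x] by blast
      ultimately show ?thesis
        by (simp add: b_simps span_scale span_base)
    qed
    show "\<omega> x y = 0" if "x \<in> A" "y \<in> span {e}" for x y
      using that Ax[of x] by (auto simp: span_singleton \<omega>_simps)
    show "w - pr w \<in> span {e}" if "\<forall>y\<in>span {e}. \<omega> w y = 0" for w
      using bspec[OF that, of e] unfolding pr_def by (simp add: span_scale span_base)
    show "\<omega> (pr v) x = \<omega> v x" if "x \<in> A" for v x
      unfolding pr_def using Ax[OF that] by (simp add: \<omega>_simps)
  qed
  have be: "b x e = \<omega> d (b x e) *\<^sub>R e" if "x \<in> V" for x
    using e(3)[OF that] d(2) by (auto simp: \<omega>_simps)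
  \<comment> \<open>the sign comes from the order of the arguments in \<open>[e, d] = \<epsilon> e\<close>\<close>
  define \<epsilon> where "\<epsilon> = - \<omega> d (b d e)"
  have "linear (\<lambda>x. \<omega> d (b x e))"
    by (rule linear_compose[unfolded o_def, OF linear_b(2) linear_\<omega>])
  then obtain p where p: "p \<in> A" "\<forall>x\<in>A. \<omega> p x = \<omega> d (b x e)"
    using riesz_on_A by blast
  have "linear (\<lambda>x. \<omega> d (b d x))"
    by (rule linear_compose[unfolded o_def, OF linear_b(1) linear_\<omega>])
  then obtain q where q: "q \<in> A" "\<forall>x\<in>A. \<omega> q x = \<omega> d (b d x)"
    using riesz_on_A by blast
  define D where "D x = pr (b d x)" for x
  define \<hh> where "\<hh> = line_extension reduced p q D \<epsilon>"
  define f where "f v = (\<omega> v e, pr v, \<omega> d v)" for v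
  have f: "linear f"
    unfolding f_def by (rule linearI) (simp_all add: \<omega>_simps linear_add[OF pr] linear_scale[OF pr])
  have decomp: "v = \<omega> v e *\<^sub>R d + pr v + \<omega> d v *\<^sub>R e" for v
    unfolding pr_def by simp
  have D: "linear_map_on A A D"
    unfolding linear_map_on_def D_def by (simp add: pr_mem b_simps linear_add[OF pr] linear_scale[OF pr])
  have bde: "b d e = - \<epsilon> *\<^sub>R e" "b e d = \<epsilon> *\<^sub>R e"
    using be[OF d(1)] b_skew[of e d] unfolding \<epsilon>_def by simp_all
  have bx: "b x e = \<omega> p x *\<^sub>R e" "b e x = - \<omega> p x *\<^sub>R e" "b x d = - b d x" "pr (b d x) = D x"
    "\<omega> d (b d x) = \<omega> q x" "\<omega> (b d x) e = \<omega> p x" if x: "x \<in> A" for x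
  proof -
    show 1: "b x e = \<omega> p x *\<^sub>R e"
      using be[OF Ax(1)[OF x]] p(2) x by simp
    then show "b e x = - \<omega> p x *\<^sub>R e"
      using b_skew[of e x] by simp
    show "b x d = - b d x" "pr (b d x) = D x" "\<omega> d (b d x) = \<omega> q x"
      using b_skew[of x d] q(2) x by (simp_all add: D_def)
    show "\<omega> (b d x) e = \<omega> p x"
      using cocycle[of d x e] 1 bde(2) Ax[OF x] d by (simp add: \<omega>_simps)
  qed
  have bxx: "\<omega> (b x y) e = 0" "\<omega> d (b x y) = \<omega> (D x) y + \<omega> x (D y)" if xy: "x \<in> A" "y \<in> A" for x y
  proof -
    show "\<omega> (b x y) e = 0"
      using cocycle[of x y e] bx[OF xy(1)] bx[OF xy(2)] Ax[OF xy(1)] Ax[OF xy(2)] by (simp add: \<omega>_simps)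
    have "\<omega> d (b x y) = \<omega> (b d x) y - \<omega> (b d y) x"
      using cocycle[of d x y] skew[of d "b x y"] bx(3)[OF xy(2)] by (simp add: \<omega>_simps)
    then show "\<omega> d (b x y) = \<omega> (D x) y + \<omega> x (D y)"
      using pr_adj[of "b d x" y] pr_adj[of "b d y" x] xy skew[of x "D y"] by (simp add: D_def)
  qed
  have br: "f (b v v') = sl_bracket \<hh> (f v) (f v')" if v: "v \<in> V" "v' \<in> V" for v v'
  proof -
    define s x t where "s = \<omega> v e" and "x = pr v" and "t = \<omega> d v"
    define s' x' t' where "s' = \<omega> v' e" and "x' = pr v'" and "t' = \<omega> d v'"
    have x: "x \<in> A" and x': "x' \<in> A"
      unfolding x_def x'_def using v by (simp_all add: pr_mem)
    have fv: "f v = (s, x, t)" "f v' = (s', x', t')"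
      unfolding f_def s_def x_def t_def s'_def x'_def t'_def by simp_all
    have "b v v' = b (s *\<^sub>R d + x + t *\<^sub>R e) (s' *\<^sub>R d + x' + t' *\<^sub>R e)"
      using decomp[of v] decomp[of v'] unfolding s_def x_def t_def s'_def x'_def t'_def by simp
    also have "\<dots> = s *\<^sub>R b d x' - s' *\<^sub>R b d x + b x x'
        + (\<epsilon> * (t * s' - s * t') + t' * \<omega> p x - t * \<omega> p x') *\<^sub>R e"
      using bx(1-3)[OF x] bx(1-3)[OF x'] bde by (simp add: b_simps algebra_simps)
    finally have "b v v' = \<dots>" .
    then show ?thesis
      unfolding fv \<hh>_def line_extension_def Let_def
      using bx(4-)[OF x] bx(4-)[OF x'] bxx[OF x x'] d pr_de
      by (simp add: f_def \<omega>_simps linear_add[OF pr] linear_diff[OF pr] linear_scale[OF pr])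
  qed
  have fo: "sl_form \<hh> (f v) (f v') = \<omega> v v'" if v: "v \<in> V" "v' \<in> V" for v v'
  proof -
    define s x t where "s = \<omega> v e" and "x = pr v" and "t = \<omega> d v"
    define s' x' t' where "s' = \<omega> v' e" and "x' = pr v'" and "t' = \<omega> d v'"
    have x: "x \<in> A" and x': "x' \<in> A"
      unfolding x_def x'_def using v by (simp_all add: pr_mem)
    have fv: "f v = (s, x, t)" "f v' = (s', x', t')"
      unfolding f_def s_def x_def t_def s'_def x'_def t'_def by simp_all
    have "\<omega> v v' = \<omega> (s *\<^sub>R d + x + t *\<^sub>R e) (s' *\<^sub>R d + x' + t' *\<^sub>R e)"
      using decomp[of v] decomp[of v'] unfolding s_def x_def t_def s'_def x'_def t'_def by simp
    also have "\<dots> = \<omega> x x' + (s * t' - t * s')"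
      using Ax[OF x] Ax[OF x'] d by (simp add: \<omega>_simps)
    finally show ?thesis
      unfolding fv \<hh>_def line_extension_def Let_def by simp
  qed
  have inj: "inj_on f V"
    using decomp by (intro inj_onI) (metis f_def prod.inject)
  have img: "sl_space \<hh> = f ` V"
  proof -
    have "(s, x, t) \<in> f ` V" if x: "x \<in> A" for s x t
    proof
      show "(s, x, t) = f (s *\<^sub>R d + x + t *\<^sub>R e)"
        using Ax[OF x] d pr_de
        by (simp add: f_def \<omega>_simps linear_add[OF pr] linear_scale[OF pr])
      show "s *\<^sub>R d + x + t *\<^sub>R e \<in> V"
        using Ax(1)[OF x] d(1) e(1) V by (simp add: subspace_add subspace_scale)
    qed
    moreover have "f ` V \<subseteq> UNIV \<times> A \<times> UNIV"
      unfolding f_def using pr_mem by auto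
    ultimately show ?thesis
      unfolding \<hh>_def line_extension_def Let_def by auto
  qed
  have h: "symplectic_lie_algebra \<hh>" "symp_lie_isomorphic alg \<hh>"
    using symplectic_transport[OF is_symplectic f] inj img br fo by simp_all
  have "is_line_double_extension reduced \<hh>"
    unfolding is_line_double_extension_def
    using reduced_symplectic h(1) p(1) q(1) D \<hh>_def by auto
  moreover have "d \<notin> A"
    using Ax(3)[of d] d by auto
  ultimately show ?thesis
    using reduced_symplectic reduced_solvable[OF solv] h A d(1)
    by (intro exI[of _ reduced] exI[of _ \<hh>]) auto
qed

section \<open>Reduction by an invariant plane\<close>

text \<open>
  Representing the dual basis of \<open>e0, e1\<close> gives all the conditions except \<open>\<omega> d0 d1 = 0\<close>. Subtracting
  \<open>\<omega> d0 d1\<close> times \<open>e0\<close> from \<open>d1\<close> achieves that one and, \<open>e0, e1\<close> being isotropic, preserves the others.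
\<close>

lemma dual_isotropic_pair:
  assumes e: "e0 \<in> V" "e1 \<in> V" "independent {e0, e1}" "e0 \<noteq> e1"
    and iso: "\<omega> e0 e1 = 0"
  obtains d0 d1 where "d0 \<in> V" "d1 \<in> V" "\<omega> d0 e0 = 1" "\<omega> d0 e1 = 0" "\<omega> d1 e0 = 0" "\<omega> d1 e1 = 1"
    "\<omega> d0 d1 = 0"
proof -
  obtain \<phi> :: "'a \<Rightarrow> real" where \<phi>: "linear \<phi>" "\<forall>x\<in>{e0, e1}. \<phi> x = (if x = e0 then 1 else 0)"
    using linear_independent_extend[OF e(3), of "\<lambda>x. if x = e0 then 1 else 0"] by blast
  obtain \<psi> :: "'a \<Rightarrow> real" where \<psi>: "linear \<psi>" "\<forall>x\<in>{e0, e1}. \<psi> x = (if x = e1 then 1 else 0)"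
    using linear_independent_extend[OF e(3), of "\<lambda>x. if x = e1 then 1 else 0"] by blast
  obtain d0 where d0: "d0 \<in> V" "\<forall>x\<in>V. \<omega> d0 x = \<phi> x"
    using riesz[OF \<phi>(1)] by blast
  obtain d where d: "d \<in> V" "\<forall>x\<in>V. \<omega> d x = \<psi> x"
    using riesz[OF \<psi>(1)] by blast
  have v: "\<omega> d0 e0 = 1" "\<omega> d0 e1 = 0" "\<omega> d e0 = 0" "\<omega> d e1 = 1"
    using \<phi>(2) \<psi>(2) d0(2) d(2) e by auto
  show thesis
    using v d0(1) d(1) e(1) V iso
    by (intro that[of d0 "d - \<omega> d0 d *\<^sub>R e0"]) (simp_all add: \<omega>_simps subspace_diff subspace_scale)
qed

text \<open>
  The plane spanned by \<open>e0, e1\<close> is an isotropic ideal on which \<open>x\<close> acts as the complex number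
  \<open>\<alpha> x + \<i> \<beta> x\<close> when \<open>e0, e1\<close> are identified with \<open>1, \<i>\<close>. As for a line, \<open>A\<close> is the orthogonal space of \<open>d0, d1, e0, e1\<close>, all functionals in
  the brackets are represented by elements of \<open>A\<close>, and the cocycle identity determines the rest: it
  yields the coordinates of \<open>[d0, x]\<close>, \<open>[d1, x]\<close> and \<open>[d0, d1]\<close> along \<open>d0, d1\<close> from the action on \<open>e0, e1\<close>,
  the coordinates of \<open>[x, y]\<close> along \<open>e0, e1\<close>, and the occurrence of \<open>b1 + z\<close> in \<open>[d1, x]\<close>.
\<close>

lemma invariant_plane_reduction:
  assumes solv: "lie_solvable alg" and e: "e0 \<in> V" "e1 \<in> V" "independent {e0, e1}" "e0 \<noteq> e1"
    and iso: "\<omega> e0 e1 = 0"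
    and act: "\<And>x. x \<in> V \<Longrightarrow>
      \<exists>\<alpha> \<beta>. b x e0 = \<alpha> *\<^sub>R e0 + \<beta> *\<^sub>R e1 \<and> b x e1 = - \<beta> *\<^sub>R e0 + \<alpha> *\<^sub>R e1"
  shows "\<exists>\<aa> \<hh>. symplectic_lie_algebra \<aa> \<and> lie_solvable \<aa> \<and> subspace (sl_space \<aa>) \<and> sl_space \<aa> \<subset> V \<and>
    is_plane_double_extension \<aa> \<hh> \<and> symp_lie_isomorphic alg \<hh>"
proof -
  obtain d0 d1 where d: "d0 \<in> V" "d1 \<in> V" and de: "\<omega> d0 e0 = 1" "\<omega> d0 e1 = 0" "\<omega> d1 e0 = 0" "\<omega> d1 e1 = 1"
    "\<omega> d0 d1 = 0"
    using dual_isotropic_pair[OF e iso] by metis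
  have de': "\<omega> e0 d0 = -1" "\<omega> e1 d0 = 0" "\<omega> e0 d1 = 0" "\<omega> e1 d1 = -1" "\<omega> d1 d0 = 0" "\<omega> e0 e1 = 0" "\<omega> e1 e0 = 0"
    using de iso skew[of e0 d0] skew[of e1 d0] skew[of e0 d1] skew[of e1 d1] skew[of d1 d0] skew[of e1 e0]
    by simp_all
  note form = de de' \<omega>_self
  define A where "A = {x \<in> V. \<omega> x d0 = 0 \<and> \<omega> x d1 = 0 \<and> \<omega> x e0 = 0 \<and> \<omega> x e1 = 0}"
  define pr where "pr v = v - \<omega> v e0 *\<^sub>R d0 - \<omega> v e1 *\<^sub>R d1 - \<omega> d0 v *\<^sub>R e0 - \<omega> d1 v *\<^sub>R e1" for v
  have pr: "linear pr"
    unfolding pr_def by (rule linearI) (simp_all add: \<omega>_simps algebra_simps)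
  have Ax: "x \<in> V" "\<omega> x d0 = 0" "\<omega> x d1 = 0" "\<omega> x e0 = 0" "\<omega> x e1 = 0"
    "\<omega> d0 x = 0" "\<omega> d1 x = 0" "\<omega> e0 x = 0" "\<omega> e1 x = 0" "pr x = x" if "x \<in> A" for x
    using that skew[of d0 x] skew[of d1 x] skew[of e0 x] skew[of e1 x] unfolding A_def pr_def by auto
  have pr_de: "pr d0 = 0" "pr d1 = 0" "pr e0 = 0" "pr e1 = 0"
    unfolding pr_def by (simp_all add: form)
  have span2: "\<exists>k l. y = k *\<^sub>R e0 + l *\<^sub>R e1" if "y \<in> span {e0, e1}" for y
    using that by (auto simp: span_insert span_singleton algebra_simps)
  have in_span2: "k *\<^sub>R e0 + l *\<^sub>R e1 \<in> span {e0, e1}" for k l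
    by (intro span_add span_scale) (simp_all add: span_base)
  interpret symplectic_reduction V b \<omega> "span {e0, e1}" A pr
  proof (intro symplectic_reduction.intro symplectic_reduction_axioms.intro)
    show "symplectic_lie V b \<omega>"
      by (fact symplectic_lie_axioms)
    show "subspace A"
      using V unfolding A_def subspace_def by (auto simp: \<omega>_simps)
    show "A \<subseteq> V"
      unfolding A_def by blast
    show "linear pr"
      by (fact pr)
    show "pr x \<in> A" if "x \<in> V" for x
      unfolding A_def pr_def using that d e(1,2) V skew[of x d0] skew[of x d1]
      by (simp add: \<omega>_simps form subspace_diff subspace_scale)
    show "pr x = x" if "x \<in> A" for x
      using Ax[OF that] by simp
    show "pr y = 0" if "y \<in> span {e0, e1}" for y
      using span2[OF that] pr_de by (auto simp: linear_add[OF pr] linear_scale[OF pr])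
    show "b x y \<in> span {e0, e1}" if x: "x \<in> V" and y: "y \<in> span {e0, e1}" for x y
    proof -
      obtain k l where "y = k *\<^sub>R e0 + l *\<^sub>R e1"
        using span2[OF y] by blast
      moreover obtain \<alpha> \<beta> where "b x e0 = \<alpha> *\<^sub>R e0 + \<beta> *\<^sub>R e1" "b x e1 = - \<beta> *\<^sub>R e0 + \<alpha> *\<^sub>R e1"
        using act[OF x] by blast
      ultimately have "b x y = k *\<^sub>R (\<alpha> *\<^sub>R e0 + \<beta> *\<^sub>R e1) + l *\<^sub>R (- \<beta> *\<^sub>R e0 + \<alpha> *\<^sub>R e1)"
        by (simp add: b_simps)
      then show ?thesis
        by (simp only:) (intro span_add span_scale in_span2)
    qed
    show "\<omega> x y = 0" if "x \<in> A" "y \<in> span {e0, e1}" for x y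
      using span2[OF that(2)] Ax[OF that(1)] by (auto simp: \<omega>_simps)
    show "w - pr w \<in> span {e0, e1}" if "\<forall>y\<in>span {e0, e1}. \<omega> w y = 0" for w
    proof -
      have "\<omega> w e0 = 0" "\<omega> w e1 = 0"
        using that by (simp_all add: span_base)
      then show ?thesis
        using in_span2[of "\<omega> d0 w" "\<omega> d1 w"] unfolding pr_def by (simp add: add.commute)
    qed
    show "\<omega> (pr v) x = \<omega> v x" if "x \<in> A" for v x
      unfolding pr_def using Ax[OF that] by (simp add: \<omega>_simps)
  qed
  define \<alpha> \<beta> where "\<alpha> x = \<omega> d0 (b x e0)" and "\<beta> x = \<omega> d1 (b x e0)" for x
  have be: "b x e0 = \<alpha> x *\<^sub>R e0 + \<beta> x *\<^sub>R e1" "b x e1 = - \<beta> x *\<^sub>R e0 + \<alpha> x *\<^sub>R e1" if x: "x \<in> V" for x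
  proof -
    obtain s t where st: "b x e0 = s *\<^sub>R e0 + t *\<^sub>R e1" "b x e1 = - t *\<^sub>R e0 + s *\<^sub>R e1"
      using act[OF x] by blast
    then have "\<alpha> x = s" "\<beta> x = t"
      unfolding \<alpha>_def \<beta>_def by (simp_all add: \<omega>_simps form)
    then show "b x e0 = \<alpha> x *\<^sub>R e0 + \<beta> x *\<^sub>R e1" "b x e1 = - \<beta> x *\<^sub>R e0 + \<alpha> x *\<^sub>R e1"
      using st by simp_all
  qed
  have lin_comp: "linear (\<lambda>x. \<omega> c (b x y))" "linear (\<lambda>x. \<omega> c (b y x))" "linear (\<lambda>x. - \<omega> c (b x y))" for c y
    by (rule linearI; simp add: b_simps \<omega>_simps)+
  obtain a0 where a0: "a0 \<in> A" "\<forall>x\<in>A. \<omega> a0 x = \<alpha> x"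
    using riesz_on_A[OF lin_comp(1)[of d0 e0]] unfolding \<alpha>_def by blast
  \<comment> \<open>the sign makes \<open>a1\<close> agree with the brackets \<open>[e0, x]\<close> and \<open>[e1, x]\<close>, opposite to the action of \<open>x\<close>\<close>
  obtain a1 where a1: "a1 \<in> A" "\<forall>x\<in>A. \<omega> a1 x = - \<beta> x"
    using riesz_on_A[OF lin_comp(3)[of d1 e0]] unfolding \<beta>_def by blast
  obtain b0 where b0: "b0 \<in> A" "\<forall>x\<in>A. \<omega> b0 x = \<omega> d0 (b d0 x)"
    using riesz_on_A[OF lin_comp(2)] by blast
  obtain b1 where b1: "b1 \<in> A" "\<forall>x\<in>A. \<omega> b1 x = \<omega> d1 (b d0 x)"
    using riesz_on_A[OF lin_comp(2)] by blast
  obtain b2 where b2: "b2 \<in> A" "\<forall>x\<in>A. \<omega> b2 x = \<omega> d1 (b d1 x)"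
    using riesz_on_A[OF lin_comp(2)] by blast
  define z where "z = pr (b d0 d1)"
  define D0 D1 where "D0 x = pr (b d0 x)" and "D1 x = pr (b d1 x)" for x
  define \<epsilon>0 \<epsilon>1 \<epsilon>2 \<epsilon>3 where "\<epsilon>0 = \<alpha> d0" and "\<epsilon>1 = \<beta> d0" and "\<epsilon>2 = \<alpha> d1" and "\<epsilon>3 = \<beta> d1"
  define \<epsilon>4 \<epsilon>5 where "\<epsilon>4 = \<omega> d0 (b d0 d1)" and "\<epsilon>5 = \<omega> d1 (b d0 d1)"
  define \<hh> where "\<hh> = plane_extension reduced a0 a1 b0 b1 b2 z D0 D1 \<epsilon>0 \<epsilon>1 \<epsilon>2 \<epsilon>3 \<epsilon>4 \<epsilon>5"
  define f where "f v = (\<omega> v e0, \<omega> v e1, pr v, \<omega> d0 v, \<omega> d1 v)" for v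
  have f: "linear f"
    unfolding f_def by (rule linearI) (simp_all add: \<omega>_simps linear_add[OF pr] linear_scale[OF pr])
  have decomp: "v = \<omega> v e0 *\<^sub>R d0 + \<omega> v e1 *\<^sub>R d1 + pr v + \<omega> d0 v *\<^sub>R e0 + \<omega> d1 v *\<^sub>R e1" for v
    unfolding pr_def by simp
  have z: "z \<in> A"
    unfolding z_def by (simp add: pr_mem)
  have D: "linear_map_on A A D0" "linear_map_on A A D1"
    unfolding linear_map_on_def D0_def D1_def
    by (simp_all add: pr_mem b_simps linear_add[OF pr] linear_scale[OF pr])
  have bee: "b e0 e1 = 0" "b e1 e0 = 0"
  proof -
    have "\<alpha> e0 = 0" "\<beta> e0 = 0"
      unfolding \<alpha>_def \<beta>_def by (simp_all add: \<omega>_simps)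
    then show "b e0 e1 = 0"
      using be(2)[OF e(1)] by simp
    then show "b e1 e0 = 0"
      using b_skew[of e1 e0] by simp
  qed
  have bde: "b d0 e0 = \<epsilon>0 *\<^sub>R e0 + \<epsilon>1 *\<^sub>R e1" "b d0 e1 = - \<epsilon>1 *\<^sub>R e0 + \<epsilon>0 *\<^sub>R e1"
    "b d1 e0 = \<epsilon>2 *\<^sub>R e0 + \<epsilon>3 *\<^sub>R e1" "b d1 e1 = - \<epsilon>3 *\<^sub>R e0 + \<epsilon>2 *\<^sub>R e1"
    unfolding \<epsilon>0_def \<epsilon>1_def \<epsilon>2_def \<epsilon>3_def using be d by simp_all
  have bed: "b e0 d0 = - \<epsilon>0 *\<^sub>R e0 - \<epsilon>1 *\<^sub>R e1" "b e1 d0 = \<epsilon>1 *\<^sub>R e0 - \<epsilon>0 *\<^sub>R e1"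
    "b e0 d1 = - \<epsilon>2 *\<^sub>R e0 - \<epsilon>3 *\<^sub>R e1" "b e1 d1 = \<epsilon>3 *\<^sub>R e0 - \<epsilon>2 *\<^sub>R e1" "b d1 d0 = - b d0 d1"
    using b_skew[of e0 d0] b_skew[of e1 d0] b_skew[of e0 d1] b_skew[of e1 d1] b_skew[of d1 d0] bde
    by simp_all
  have bdd: "\<omega> (b d0 d1) e0 = \<epsilon>2 - \<epsilon>1" "\<omega> (b d0 d1) e1 = - (\<epsilon>0 + \<epsilon>3)"
    using cocycle[of d0 d1 e0] cocycle[of d0 d1 e1] bde bed by (simp_all add: \<omega>_simps form)
  have bx: "b x e0 = \<omega> a0 x *\<^sub>R e0 - \<omega> a1 x *\<^sub>R e1" "b x e1 = \<omega> a1 x *\<^sub>R e0 + \<omega> a0 x *\<^sub>R e1"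
    "b e0 x = - \<omega> a0 x *\<^sub>R e0 + \<omega> a1 x *\<^sub>R e1" "b e1 x = - \<omega> a1 x *\<^sub>R e0 - \<omega> a0 x *\<^sub>R e1"
    "b x d0 = - b d0 x" "b x d1 = - b d1 x" if x: "x \<in> A" for x
  proof -
    show 1: "b x e0 = \<omega> a0 x *\<^sub>R e0 - \<omega> a1 x *\<^sub>R e1" "b x e1 = \<omega> a1 x *\<^sub>R e0 + \<omega> a0 x *\<^sub>R e1"
      using be[OF Ax(1)[OF x]] a0(2) a1(2) x by simp_all
    then show "b e0 x = - \<omega> a0 x *\<^sub>R e0 + \<omega> a1 x *\<^sub>R e1" "b e1 x = - \<omega> a1 x *\<^sub>R e0 - \<omega> a0 x *\<^sub>R e1"
      using b_skew[of e0 x] b_skew[of e1 x] by simp_all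
    show "b x d0 = - b d0 x" "b x d1 = - b d1 x"
      by (rule b_skew)+
  qed
  have bdx: "pr (b d0 x) = D0 x" "pr (b d1 x) = D1 x"
    "\<omega> (b d0 x) e0 = \<omega> a0 x" "\<omega> (b d0 x) e1 = \<omega> a1 x"
    "\<omega> (b d1 x) e0 = - \<omega> a1 x" "\<omega> (b d1 x) e1 = \<omega> a0 x"
    "\<omega> d0 (b d0 x) = \<omega> b0 x" "\<omega> d1 (b d0 x) = \<omega> b1 x"
    "\<omega> d0 (b d1 x) = \<omega> (b1 + z) x" "\<omega> d1 (b d1 x) = \<omega> b2 x" if x: "x \<in> A" for x
  proof -
    show "pr (b d0 x) = D0 x" "pr (b d1 x) = D1 x"
      "\<omega> d0 (b d0 x) = \<omega> b0 x" "\<omega> d1 (b d1 x) = \<omega> b2 x"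
      using b0(2) b2(2) x by (simp_all add: D0_def D1_def)
    show "\<omega> (b d0 x) e0 = \<omega> a0 x" "\<omega> (b d0 x) e1 = \<omega> a1 x"
      "\<omega> (b d1 x) e0 = - \<omega> a1 x" "\<omega> (b d1 x) e1 = \<omega> a0 x"
      using cocycle[of d0 x e0] cocycle[of d0 x e1] cocycle[of d1 x e0] cocycle[of d1 x e1]
        bx(1-2)[OF x] bed Ax[OF x] by (simp_all add: \<omega>_simps form)
    show 1: "\<omega> d1 (b d0 x) = \<omega> b1 x"
      using b1(2) x by simp
    \<comment> \<open>this instance of the cocycle identity is the origin of the summand \<open>z\<close> in \<open>b1 + z\<close>\<close>
    have "\<omega> d0 (b d1 x) = \<omega> (b d0 d1) x + \<omega> d1 (b d0 x)"
      using cocycle[of d0 d1 x] skew[of d0 "b d1 x"] skew[of d1 "b d0 x"] bx(5)[OF x] by (simp add: \<omega>_simps)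
    then show "\<omega> d0 (b d1 x) = \<omega> (b1 + z) x"
      using pr_adj[OF b_mem x] 1 by (simp add: \<omega>_simps z_def)
  qed
  have bxx: "\<omega> (b x y) e0 = 0" "\<omega> (b x y) e1 = 0" "\<omega> d0 (b x y) = \<omega> (D0 x) y + \<omega> x (D0 y)"
    "\<omega> d1 (b x y) = \<omega> (D1 x) y + \<omega> x (D1 y)" if xy: "x \<in> A" "y \<in> A" for x y
  proof -
    show "\<omega> (b x y) e0 = 0" "\<omega> (b x y) e1 = 0"
      using cocycle[of x y e0] cocycle[of x y e1] bx(1-4)[OF xy(1)] bx(1-4)[OF xy(2)] Ax[OF xy(1)] Ax[OF xy(2)]
      by (simp_all add: \<omega>_simps)
    have "\<omega> d0 (b x y) = \<omega> (b d0 x) y - \<omega> (b d0 y) x"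
      using cocycle[of d0 x y] skew[of d0 "b x y"] bx(5)[OF xy(2)] by (simp add: \<omega>_simps)
    then show "\<omega> d0 (b x y) = \<omega> (D0 x) y + \<omega> x (D0 y)"
      using pr_adj[of "b d0 x" y] pr_adj[of "b d0 y" x] xy skew[of x "D0 y"] by (simp add: D0_def)
    have "\<omega> d1 (b x y) = \<omega> (b d1 x) y - \<omega> (b d1 y) x"
      using cocycle[of d1 x y] skew[of d1 "b x y"] bx(6)[OF xy(2)] by (simp add: \<omega>_simps)
    then show "\<omega> d1 (b x y) = \<omega> (D1 x) y + \<omega> x (D1 y)"
      using pr_adj[of "b d1 x" y] pr_adj[of "b d1 y" x] xy skew[of x "D1 y"] by (simp add: D1_def)
  qed
  have br: "f (b v v') = sl_bracket \<hh> (f v) (f v')" if v: "v \<in> V" "v' \<in> V" for v v'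
  proof -
    define s0 s1 x t0 t1 where "s0 = \<omega> v e0" and "s1 = \<omega> v e1" and "x = pr v" and "t0 = \<omega> d0 v" and "t1 = \<omega> d1 v"
    note vdefs = this
    define s0' s1' x' t0' t1' where "s0' = \<omega> v' e0" and "s1' = \<omega> v' e1" and "x' = pr v'" and "t0' = \<omega> d0 v'" and "t1' = \<omega> d1 v'"
    note vdefs = vdefs this
    have x: "x \<in> A" and x': "x' \<in> A"
      unfolding vdefs using v by (simp_all add: pr_mem)
    have fv: "f v = (s0, s1, x, t0, t1)" "f v' = (s0', s1', x', t0', t1')"
      unfolding f_def vdefs by simp_all
    have "b v v' = b (s0 *\<^sub>R d0 + s1 *\<^sub>R d1 + x + t0 *\<^sub>R e0 + t1 *\<^sub>R e1)
        (s0' *\<^sub>R d0 + s1' *\<^sub>R d1 + x' + t0' *\<^sub>R e0 + t1' *\<^sub>R e1)"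
      using decomp[of v] decomp[of v'] unfolding vdefs by simp
    also have "\<dots> = (s0 * s1' - s1 * s0') *\<^sub>R b d0 d1 + s0 *\<^sub>R b d0 x' - s0' *\<^sub>R b d0 x
        + s1 *\<^sub>R b d1 x' - s1' *\<^sub>R b d1 x + b x x'
        + (\<epsilon>0 * (s0 * t0' - t0 * s0') - \<epsilon>1 * (s0 * t1' - t1 * s0')
           + \<epsilon>2 * (s1 * t0' - t0 * s1') - \<epsilon>3 * (s1 * t1' - t1 * s1')
           - (t0 * \<omega> a0 x' - t0' * \<omega> a0 x) - (t1 * \<omega> a1 x' - t1' * \<omega> a1 x)) *\<^sub>R e0
        + (\<epsilon>1 * (s0 * t0' - t0 * s0') + \<epsilon>0 * (s0 * t1' - t1 * s0')
           + \<epsilon>3 * (s1 * t0' - t0 * s1') + \<epsilon>2 * (s1 * t1' - t1 * s1')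
           + (t0 * \<omega> a1 x' - t0' * \<omega> a1 x) - (t1 * \<omega> a0 x' - t1' * \<omega> a0 x)) *\<^sub>R e1"
      by (simp add: b_simps bx[OF x] bx[OF x'] bde bed bee algebra_simps)
    finally have expand: "b v v' = \<dots>" .
    show ?thesis
      unfolding fv \<hh>_def plane_extension_def Let_def unfolding f_def expand
      by (simp add: \<omega>_simps form bdx[OF x] bdx[OF x'] bxx[OF x x'] pr_de bdd \<epsilon>4_def \<epsilon>5_def
          linear_add[OF pr] linear_diff[OF pr] linear_scale[OF pr] z_def[symmetric])
  qed
  have fo: "sl_form \<hh> (f v) (f v') = \<omega> v v'" if v: "v \<in> V" "v' \<in> V" for v v'
  proof -
    define s0 s1 x t0 t1 where "s0 = \<omega> v e0" and "s1 = \<omega> v e1" and "x = pr v" and "t0 = \<omega> d0 v" and "t1 = \<omega> d1 v"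
    note vdefs = this
    define s0' s1' x' t0' t1' where "s0' = \<omega> v' e0" and "s1' = \<omega> v' e1" and "x' = pr v'" and "t0' = \<omega> d0 v'" and "t1' = \<omega> d1 v'"
    note vdefs = vdefs this
    have x: "x \<in> A" and x': "x' \<in> A"
      unfolding vdefs using v by (simp_all add: pr_mem)
    have fv: "f v = (s0, s1, x, t0, t1)" "f v' = (s0', s1', x', t0', t1')"
      unfolding f_def vdefs by simp_all
    have "\<omega> v v' = \<omega> (s0 *\<^sub>R d0 + s1 *\<^sub>R d1 + x + t0 *\<^sub>R e0 + t1 *\<^sub>R e1)
        (s0' *\<^sub>R d0 + s1' *\<^sub>R d1 + x' + t0' *\<^sub>R e0 + t1' *\<^sub>R e1)"
      using decomp[of v] decomp[of v'] unfolding vdefs by simp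
    also have "\<dots> = \<omega> x x' + (s0 * t0' - t0 * s0') + (s1 * t1' - t1 * s1')"
      using Ax[OF x] Ax[OF x'] by (simp add: \<omega>_simps form)
    finally show ?thesis
      unfolding fv \<hh>_def plane_extension_def Let_def by simp
  qed
  have inj: "inj_on f V"
    using decomp by (intro inj_onI) (metis f_def prod.inject)
  have img: "sl_space \<hh> = f ` V"
  proof -
    have "(s0, s1, x, t0, t1) \<in> f ` V" if x: "x \<in> A" for s0 s1 x t0 t1
    proof
      show "(s0, s1, x, t0, t1) = f (s0 *\<^sub>R d0 + s1 *\<^sub>R d1 + x + t0 *\<^sub>R e0 + t1 *\<^sub>R e1)"
        using Ax[OF x] pr_de
        by (simp add: f_def form \<omega>_simps linear_add[OF pr] linear_scale[OF pr])
      show "s0 *\<^sub>R d0 + s1 *\<^sub>R d1 + x + t0 *\<^sub>R e0 + t1 *\<^sub>R e1 \<in> V"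
        using Ax(1)[OF x] d e(1,2) V by (simp add: subspace_add subspace_scale)
    qed
    moreover have "f ` V \<subseteq> UNIV \<times> UNIV \<times> A \<times> UNIV \<times> UNIV"
      unfolding f_def using pr_mem by auto
    ultimately show ?thesis
      unfolding \<hh>_def plane_extension_def Let_def by auto
  qed
  have h: "symplectic_lie_algebra \<hh>" "symp_lie_isomorphic alg \<hh>"
    using symplectic_transport[OF is_symplectic f] inj img br fo by simp_all
  have "is_plane_double_extension reduced \<hh>"
    unfolding is_plane_double_extension_def
  proof (intro conjI)
    show "symplectic_lie_algebra reduced" "symplectic_lie_algebra \<hh>"
      by (fact reduced_symplectic h(1))+
    show "\<exists>a0\<in>sl_space reduced. \<exists>a1\<in>sl_space reduced. \<exists>b0\<in>sl_space reduced. \<exists>b1\<in>sl_space reduced.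
      \<exists>b2\<in>sl_space reduced. \<exists>z\<in>sl_space reduced. \<exists>D0 D1 \<epsilon>0 \<epsilon>1 \<epsilon>2 \<epsilon>3 \<epsilon>4 \<epsilon>5.
        linear_map_on (sl_space reduced) (sl_space reduced) D0 \<and>
        linear_map_on (sl_space reduced) (sl_space reduced) D1 \<and>
        \<hh> = plane_extension reduced a0 a1 b0 b1 b2 z D0 D1 \<epsilon>0 \<epsilon>1 \<epsilon>2 \<epsilon>3 \<epsilon>4 \<epsilon>5"
      unfolding symp_lie.simps
      by (rule bexI[OF _ a0(1)], rule bexI[OF _ a1(1)], rule bexI[OF _ b0(1)], rule bexI[OF _ b1(1)],
          rule bexI[OF _ b2(1)], rule bexI[OF _ z], intro exI conjI, rule D, rule D, rule \<hh>_def)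
  qed
  moreover have "d0 \<notin> A"
    using Ax(4)[of d0] de by auto
  ultimately show ?thesis
    using reduced_symplectic reduced_solvable[OF solv] h A d(1)
    by (intro exI[of _ reduced] exI[of _ \<hh>]) auto
qed

end

section \<open>Iterating the reduction\<close>

lemma extend_to_ambient_space:
  fixes \<gg> :: "'a::real_vector symp_lie"
  assumes "symplectic_lie_algebra \<gg>"
  obtains b \<omega> where "symplectic_lie (sl_space \<gg>) b \<omega>"
    "\<And>x y. x \<in> sl_space \<gg> \<Longrightarrow> y \<in> sl_space \<gg> \<Longrightarrow> b x y = sl_bracket \<gg> x y"
    "\<And>x y. x \<in> sl_space \<gg> \<Longrightarrow> y \<in> sl_space \<gg> \<Longrightarrow> \<omega> x y = sl_form \<gg> x y"
proof -
  let ?V = "sl_space \<gg>" and ?b = "sl_bracket \<gg>" and ?w = "sl_form \<gg>"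
  have L: "lie_algebra_on ?V ?b" and bw: "bilinear_map_on ?V UNIV ?w"
    and sk: "\<forall>x\<in>?V. \<forall>y\<in>?V. ?w x y = - ?w y x"
    and nd: "\<forall>x\<in>?V. (\<forall>y\<in>?V. ?w x y = 0) \<longrightarrow> x = 0"
    and co: "\<forall>x\<in>?V. \<forall>y\<in>?V. \<forall>z\<in>?V. ?w (?b x y) z + ?w (?b y z) x + ?w (?b z x) y = 0"
    using assms unfolding symplectic_lie_algebra_def Let_def by - (elim conjE, assumption)+
  have V: "subspace ?V" and fin: "\<exists>B. finite B \<and> span B = ?V" and bb: "bilinear_map_on ?V ?V ?b"
    and alt: "\<forall>x\<in>?V. ?b x x = 0"
    and jac: "\<forall>x\<in>?V. \<forall>y\<in>?V. \<forall>z\<in>?V. ?b x (?b y z) + ?b y (?b z x) + ?b z (?b x y) = 0"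
    using L unfolding lie_algebra_on_def by - (elim conjE, assumption)+
  have mem: "?b x y \<in> ?V" if "x \<in> ?V" "y \<in> ?V" for x y
    using bb that unfolding bilinear_map_on_def linear_map_on_def by blast
  have "inj_on (\<lambda>x. x) ?V"
    by (simp add: inj_on_def)
  then obtain \<pi> where \<pi>: "\<pi> ` UNIV \<subseteq> ?V" "linear \<pi>" "\<forall>v\<in>?V. \<pi> v = v"
    using linear_exists_left_inverse_on[OF linear_ident V] by blast
  have \<pi>V: "\<pi> x \<in> ?V" for x
    using \<pi>(1) by blast
  have bil: "bilinear (\<lambda>x y. h (\<pi> x) (\<pi> y))" if "bilinear_map_on ?V W h"
    for h :: "'a \<Rightarrow> 'a \<Rightarrow> 'c::real_vector" and W
    using that \<pi>V unfolding bilinear_map_on_def linear_map_on_def bilinear_def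
    by (auto intro!: linearI simp: linear_add[OF \<pi>(2)] linear_scale[OF \<pi>(2)])
  show thesis
  proof (rule that[of "\<lambda>x y. ?b (\<pi> x) (\<pi> y)" "\<lambda>x y. ?w (\<pi> x) (\<pi> y)"])
    show "symplectic_lie ?V (\<lambda>x y. ?b (\<pi> x) (\<pi> y)) (\<lambda>x y. ?w (\<pi> x) (\<pi> y))"
    proof
      show "x = 0" if "x \<in> ?V" "\<forall>y\<in>?V. ?w (\<pi> x) (\<pi> y) = 0" for x
        using nd that \<pi>(3) by simp
      show "?w (\<pi> x) (\<pi> y) = - ?w (\<pi> y) (\<pi> x)" for x y
        using sk \<pi>V by blast
    qed (use V fin bil[OF bb] bil[OF bw] mem \<pi>V \<pi>(3) alt jac co in simp_all)
  qed (use \<pi>(3) in simp_all)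
qed

lemma lie_derived_series_cong:
  assumes "symplectic_lie_algebra \<gg>" "sl_space \<hh> = sl_space \<gg>"
    and "\<And>x y. x \<in> sl_space \<gg> \<Longrightarrow> y \<in> sl_space \<gg> \<Longrightarrow> sl_bracket \<hh> x y = sl_bracket \<gg> x y"
  shows "lie_derived_series \<hh> k = lie_derived_series \<gg> k \<and> lie_derived_series \<gg> k \<subseteq> sl_space \<gg>"
proof (induction k)
  case 0
  show ?case
    using assms(2) by simp
next
  case (Suc k)
  let ?B = "\<lambda>\<gg>. {sl_bracket \<gg> x y |x y. x \<in> lie_derived_series \<gg> k \<and> y \<in> lie_derived_series \<gg> k}"
  have "?B \<hh> = ?B \<gg>"
    using Suc assms(3) by (metis (no_types, lifting) subsetD)
  moreover have "?B \<gg> \<subseteq> sl_space \<gg>"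
    using Suc symplectic_lie_algebraD(2)[OF assms(1)] unfolding bilinear_map_on_def linear_map_on_def by blast
  ultimately show ?case
    using span_minimal[OF _ symplectic_lie_algebraD(1)[OF assms(1)]] by simp
qed

text \<open>
  The isotropy of \<open>J\<close> is inherited by the invariant line or plane that it contains, which is what
  the reduction by a plane requires; a line is isotropic anyway.
\<close>

lemma reduction_step:
  fixes \<gg> :: "'a::real_vector symp_lie"
  assumes g: "symplectic_lie_algebra \<gg>" and solv: "lie_solvable \<gg>"
    and J: "lie_ideal \<gg> J" "symp_isotropic \<gg> J" "J \<noteq> {0}"
  shows "\<exists>\<aa> :: 'a symp_lie. symplectic_lie_algebra \<aa> \<and> lie_solvable \<aa> \<and> dim (sl_space \<aa>) < dim (sl_space \<gg>) \<and>
    ((\<exists>\<hh>. is_line_double_extension \<aa> \<hh> \<and> symp_lie_isomorphic \<gg> \<hh>) \<or>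
     (\<exists>\<hh>. is_plane_double_extension \<aa> \<hh> \<and> symp_lie_isomorphic \<gg> \<hh>))"
proof -
  obtain b \<omega> where S: "symplectic_lie (sl_space \<gg>) b \<omega>"
    and b_eq: "\<And>x y. x \<in> sl_space \<gg> \<Longrightarrow> y \<in> sl_space \<gg> \<Longrightarrow> b x y = sl_bracket \<gg> x y"
    and \<omega>_eq: "\<And>x y. x \<in> sl_space \<gg> \<Longrightarrow> y \<in> sl_space \<gg> \<Longrightarrow> \<omega> x y = sl_form \<gg> x y"
    by (rule extend_to_ambient_space[OF g]) (rule that)
  interpret symplectic_lie "sl_space \<gg>" b \<omega>
    by (fact S)
  have JV: "J \<subseteq> sl_space \<gg>"
    using J(1) unfolding lie_ideal_def by blast
  have solv': "lie_solvable alg"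
    using solv lie_derived_series_cong[OF g, of alg] b_eq unfolding lie_solvable_def by simp
  have J': "lie_ideal alg J"
    using J(1) b_eq unfolding lie_ideal_def by auto
  have iso: "symp_lie_isomorphic \<gg> \<hh>" if "symp_lie_isomorphic alg \<hh>" for \<hh> :: "'c::real_vector symp_lie"
    using that b_eq \<omega>_eq unfolding symp_lie_isomorphic_def by simp
  obtain B where B: "finite B" "span B = sl_space \<gg>"
    using finite_span by blast
  have less: "dim (sl_space \<aa>) < dim (sl_space \<gg>)"
    if "subspace (sl_space \<aa>)" "sl_space \<aa> \<subset> sl_space \<gg>" for \<aa> :: "'a symp_lie"
    using real_vector.dim_psubset_finite_span[OF that(1), of "sl_space \<gg>" B] that(2) B by blast
  from solv' J' J(3) show ?thesis
  proof (cases rule: minimal_ideal_in_ideal)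
    case (line e)
    from invariant_line_reduction[OF solv' subsetD[OF JV line(1)] line(2,3)] show ?thesis
      using less iso by blast
  next
    case (plane e0 e1)
    have "e0 \<in> symp_perp \<gg> J"
      using J(2) plane(1) unfolding symp_isotropic_def by (rule subsetD)
    then have "sl_form \<gg> e0 e1 = 0"
      using plane(2) unfolding symp_perp_def by simp
    then have "\<omega> e0 e1 = 0"
      using \<omega>_eq subsetD[OF JV plane(1)] subsetD[OF JV plane(2)] by simp
    from invariant_plane_reduction[OF solv' subsetD[OF JV plane(1)] subsetD[OF JV plane(2)] plane(3,4) this plane(5)]
    show ?thesis
      using less iso by blast
  qed
qed

lemma symp_lie_isomorphic_refl: "symp_lie_isomorphic \<gg> \<gg>"
  unfolding symp_lie_isomorphic_def linear_map_on_def by (intro exI[of _ "\<lambda>x. x"]) (simp add: bij_betw_def inj_on_def)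

text \<open>
  Induction on the dimension. The tower is required to end in \<open>\<gg>\<close> itself and not merely in an
  isomorphic copy, so that the reduced algebra at the top of its tower can be extended once more.
\<close>

lemma tower_of_double_extensions:
  fixes \<gg> :: "'a::real_vector symp_lie"
  assumes "symplectic_lie_algebra \<gg>" "lie_solvable \<gg>"
  shows "\<exists>n (\<aa> :: nat \<Rightarrow> 'a symp_lie). \<aa> n = \<gg> \<and> lie_solvable (\<aa> 0) \<and>
    \<not> (\<exists>I. lie_ideal (\<aa> 0) I \<and> symp_isotropic (\<aa> 0) I \<and> I \<noteq> {0}) \<and>
    (\<forall>i\<le>n. symplectic_lie_algebra (\<aa> i)) \<and>
    (\<forall>i<n. (\<exists>\<hh>. is_line_double_extension (\<aa> i) \<hh> \<and> symp_lie_isomorphic (\<aa> (Suc i)) \<hh>) \<or>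
           (\<exists>\<hh>. is_plane_double_extension (\<aa> i) \<hh> \<and> symp_lie_isomorphic (\<aa> (Suc i)) \<hh>))"
  using assms
proof (induction "dim (sl_space \<gg>)" arbitrary: \<gg> rule: less_induct)
  case less
  show ?case
  proof (cases "\<exists>I. lie_ideal \<gg> I \<and> symp_isotropic \<gg> I \<and> I \<noteq> {0}")
    case False
    then show ?thesis
      using less.prems by (intro exI[of _ 0] exI[of _ "\<lambda>_. \<gg>"]) simp
  next
    case True
    then obtain \<aa>' :: "'a symp_lie" where a': "symplectic_lie_algebra \<aa>'" "lie_solvable \<aa>'"
      "dim (sl_space \<aa>') < dim (sl_space \<gg>)"
      and step: "(\<exists>\<hh>. is_line_double_extension \<aa>' \<hh> \<and> symp_lie_isomorphic \<gg> \<hh>) \<or>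
        (\<exists>\<hh>. is_plane_double_extension \<aa>' \<hh> \<and> symp_lie_isomorphic \<gg> \<hh>)"
      using reduction_step[OF less.prems] by blast
    obtain n and \<aa> :: "nat \<Rightarrow> 'a symp_lie" where n: "\<aa> n = \<aa>'" and z: "lie_solvable (\<aa> 0)"
      "\<not> (\<exists>I. lie_ideal (\<aa> 0) I \<and> symp_isotropic (\<aa> 0) I \<and> I \<noteq> {0})"
      and s: "\<forall>i\<le>n. symplectic_lie_algebra (\<aa> i)"
      and t: "\<forall>i<n. (\<exists>\<hh>. is_line_double_extension (\<aa> i) \<hh> \<and> symp_lie_isomorphic (\<aa> (Suc i)) \<hh>) \<or>
           (\<exists>\<hh>. is_plane_double_extension (\<aa> i) \<hh> \<and> symp_lie_isomorphic (\<aa> (Suc i)) \<hh>)"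
      using less.hyps[OF a'(3,1,2)] by (elim exE conjE) (rule that)
    show ?thesis
    proof (intro exI[of _ "Suc n"] exI[of _ "\<aa>(Suc n := \<gg>)"] conjI allI impI)
      fix i assume i: "i < Suc n"
      show "(\<exists>\<hh>. is_line_double_extension ((\<aa>(Suc n := \<gg>)) i) \<hh> \<and> symp_lie_isomorphic ((\<aa>(Suc n := \<gg>)) (Suc i)) \<hh>) \<or>
           (\<exists>\<hh>. is_plane_double_extension ((\<aa>(Suc n := \<gg>)) i) \<hh> \<and> symp_lie_isomorphic ((\<aa>(Suc n := \<gg>)) (Suc i)) \<hh>)"
      proof (cases "i = n")
        case True
        then show ?thesis
          using step n by simp
      next
        case False
        then show ?thesis
          using t i by simp
      qed
    qed (use z s less.prems in auto)
  qed
qed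

theorem corollary5p1:
  fixes \<gg> :: "'a::real_vector symp_lie"
  assumes "symplectic_lie_algebra \<gg>"
    and "lie_solvable \<gg>"
    and "\<exists>I. lie_ideal \<gg> I \<and> symp_isotropic \<gg> I \<and> I \<noteq> {0}"
  shows "\<exists>\<aa>\<^sub>0 :: 'a symp_lie.
           symplectic_lie_algebra \<aa>\<^sub>0 \<and> lie_solvable \<aa>\<^sub>0 \<and>
           \<not> (\<exists>I. lie_ideal \<aa>\<^sub>0 I \<and> symp_isotropic \<aa>\<^sub>0 I \<and> I \<noteq> {0}) \<and>
           obtained_by_double_extensions \<aa>\<^sub>0 \<gg>"
proof -
  obtain n and \<aa> :: "nat \<Rightarrow> 'a symp_lie" where n: "\<aa> n = \<gg>" and z: "lie_solvable (\<aa> 0)"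
    "\<not> (\<exists>I. lie_ideal (\<aa> 0) I \<and> symp_isotropic (\<aa> 0) I \<and> I \<noteq> {0})"
    and s: "\<forall>i\<le>n. symplectic_lie_algebra (\<aa> i)"
    and t: "\<forall>i<n. (\<exists>\<hh>. is_line_double_extension (\<aa> i) \<hh> \<and> symp_lie_isomorphic (\<aa> (Suc i)) \<hh>) \<or>
         (\<exists>\<hh>. is_plane_double_extension (\<aa> i) \<hh> \<and> symp_lie_isomorphic (\<aa> (Suc i)) \<hh>)"
    using tower_of_double_extensions[OF assms(1,2)] by (elim exE conjE) (rule that)
  have "obtained_by_double_extensions (\<aa> 0) \<gg>"
    unfolding obtained_by_double_extensions_def
    using s t symp_lie_isomorphic_refl[of \<gg>] n by (intro exI[of _ n] exI[of _ \<aa>]) simp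
  then show ?thesis
    using z s by (intro exI[of _ "\<aa> 0"]) simp
qed

end
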